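(* Let $\nu\in(0,1)$, let $\{S(t):t\geq 0\}$ be a real-valued Lévy process such that $\kappa_S(\theta):=\log\mathbb{E}[e^{\theta S(1)}]$ is finite in a neighborhood of $\theta=0$, and let $\{L_\nu(t):t\geq 0\}$ be an inverse of a stable subordinator of index $\nu$, independent of $\{S(t):t\geq 0\}$. Set $m:=\kappa_S'(0)$ and $q:=\kappa_S''(0)$, and let $$\alpha(\nu):=\begin{cases}1-\nu/2 & \text{if } m=0,\\ 1-\nu & \text{if } m\neq 0.\end{cases}$$ Then, as $t\to\infty$: (i) if $m=0$, then $\left\{t^{\alpha(\nu)}\frac{S(L_\nu(t))}{t}:t>0\right\}$ converges weakly to $\sqrt{qL_\nu(1)}\,Z$, where $Z$ is a standard Normal distributed random variable independent of $L_\nu(1)$; (ii) if $m\neq 0$, then $\left\{t^{\alpha(\nu)}\frac{S(L_\nu(t))}{t}:t>0\right\}$ converges weakly to $mL_\nu(1)$.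
   Context: Inverse of a stable subordinator: for $\nu\in(0,1)$, $L_\nu(t)=\inf\{u\geq 0: H_\nu(u)>t\}$, where $\{H_\nu(u):u\ge 0\}$ is the stable subordinator with $\mathbb{E}[e^{-\xi H_\nu(u)}]=e^{-u\xi^\nu}$ for $\xi\geq 0$. Its moment generating function is $\mathbb{E}[e^{\theta L_\nu(t)}]=E_\nu(\theta t^\nu)$ for all $\theta\in\mathbb{R}$, where $E_\nu(x):=\sum_{k=0}^\infty\frac{x^k}{\Gamma(\nu k+1)}$ is the Mittag-Leffler function. Weak convergence means convergence in distribution. *)

theory Defs
  imports "HOL-Probability.Probability"
begin

definition cadlag :: "(real \<Rightarrow> real) \<Rightarrow> bool" where
  "cadlag f \<longleftrightarrow> (\<forall>t\<ge>0. (f \<longlongrightarrow> f t) (at_right t)) \<and> (\<forall>t>0. \<exists>l. (f \<longlongrightarrow> l) (at_left t))"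

text \<open>Processes are functions on all reals, but only the times \<open>t \<ge> 0\<close> are constrained.
  Stochastic continuity follows from stationarity of the increments and
  almost sure right-continuity, so it is not listed separately.\<close>

locale levy_process = prob_space M for M :: "'a measure" +
  fixes X :: "real \<Rightarrow> 'a \<Rightarrow> real"
  assumes random_variable: "\<And>t. 0 \<le> t \<Longrightarrow> random_variable borel (X t)"
    and start: "AE \<omega> in M. X 0 \<omega> = 0"
    and indep_increments:
      "\<And>(\<tau> :: nat \<Rightarrow> real) n. 0 \<le> \<tau> 0 \<Longrightarrow> mono_on {..n} \<tau> \<Longrightarrow>
        indep_vars (\<lambda>_. borel) (\<lambda>i \<omega>. X (\<tau> (Suc i)) \<omega> - X (\<tau> i) \<omega>) {..<n}"
    and stationary_increments:
      "\<And>s t. 0 \<le> s \<Longrightarrow> s \<le> t \<Longrightarrow>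
        distr M borel (\<lambda>\<omega>. X t \<omega> - X s \<omega>) = distr M borel (X (t - s))"
    and cadlag_paths: "AE \<omega> in M. cadlag (\<lambda>t. X t \<omega>)"

text \<open>The Laplace transform identity entails integrability, since its right-hand side is
  nonzero while the Bochner integral of a non-integrable function is \<open>0\<close>.\<close>

locale stable_subordinator = levy_process M H
  for M :: "'a measure" and H :: "real \<Rightarrow> 'a \<Rightarrow> real" +
  fixes \<nu> :: real
  assumes nondecreasing_paths: "AE \<omega> in M. mono_on {0..} (\<lambda>u. H u \<omega>)"
    and laplace_transform:
      "\<And>u \<xi>. 0 \<le> u \<Longrightarrow> 0 \<le> \<xi> \<Longrightarrow>
        expectation (\<lambda>\<omega>. exp (- \<xi> * H u \<omega>)) = exp (- u * \<xi> powr \<nu>)"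

text \<open>The set below is nonempty for almost every \<open>\<omega>\<close> when \<open>H\<close> is a stable subordinator,
  so the unspecified value of \<open>Inf {}\<close> on the reals matters only on a null set.\<close>

definition inverse_process :: "(real \<Rightarrow> 'a \<Rightarrow> real) \<Rightarrow> real \<Rightarrow> 'a \<Rightarrow> real" where
  "inverse_process H t \<omega> = Inf {u. 0 \<le> u \<and> t < H u \<omega>}"

definition indep_processes ::
    "'a measure \<Rightarrow> (real \<Rightarrow> 'a \<Rightarrow> real) \<Rightarrow> (real \<Rightarrow> 'a \<Rightarrow> real) \<Rightarrow> bool" where
  "indep_processes M X Y \<longleftrightarrow>
    prob_space.indep_var M
      (PiM {0..} (\<lambda>_. borel)) (\<lambda>\<omega>. \<lambda>t\<in>{0..}. X t \<omega>)
      (PiM {0..} (\<lambda>_. borel)) (\<lambda>\<omega>. \<lambda>t\<in>{0..}. Y t \<omega>)"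

text \<open>The cumulant generating function is meaningful only where \<open>exp (\<theta> * X)\<close> is integrable.\<close>

definition cgf :: "'a measure \<Rightarrow> ('a \<Rightarrow> real) \<Rightarrow> real \<Rightarrow> real" where
  "cgf M X \<theta> = ln (\<integral>\<omega>. exp (\<theta> * X \<omega>) \<partial>M)"

text \<open>This is the library's \<open>weak_conv_m\<close> with the sequential limit replaced by \<open>t \<rightarrow> \<infinity>\<close>.
  Laws are taken under the completion of \<open>M\<close>: since paths are only almost surely cadlag, a
  subordinated process such as \<open>\<lambda>\<omega>. S (L t \<omega>) \<omega>\<close> agrees almost everywhere with a random variable
  but need not be measurable itself when \<open>M\<close> is not complete. For \<open>M\<close>-measurable \<open>X t\<close> the law
  is the usual \<open>distr M borel (X t)\<close>.\<close>

definition converges_in_distribution ::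
    "'a measure \<Rightarrow> (real \<Rightarrow> 'a \<Rightarrow> real) \<Rightarrow> real measure \<Rightarrow> bool" where
  "converges_in_distribution M X \<mu> \<longleftrightarrow>
    (\<forall>t>0. X t \<in> borel_measurable (completion M)) \<and>
    (\<forall>x. isCont (cdf \<mu>) x \<longrightarrow>
      ((\<lambda>t. cdf (distr (completion M) borel (X t)) x) \<longlongrightarrow> cdf \<mu> x) at_top)"

end

theory Submission
  imports Defs "HOL-Real_Asymp.Real_Asymp"
begin

text \<open>
  The proof compares characteristic functions. Let \<open>\<phi>\<close> be the characteristic function of \<open>S 1\<close>.
  Finiteness of exponential moments near \<open>0\<close> makes \<open>\<phi>\<close> and the moment generating function the same
  power series at imaginary and real arguments (\<open>exp_moment_sums\<close>), so the derivatives \<open>m\<close> and \<open>q\<close>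
  of the cumulant generating function give an expansion \<open>\<phi> u = 1 + c * u ^ p + o(u ^ p)\<close>, with
  \<open>p = 1\<close>, \<open>c = \<i> * m\<close> if \<open>m \<noteq> 0\<close>, and \<open>p = 2\<close>, \<open>c = - q / 2\<close> if \<open>m = 0\<close>
  (\<open>deriv_cgf_zero\<close>, \<open>char_expansion\<close>). The two parts of the theorem are the cases \<open>p = 1\<close> and
  \<open>p = 2\<close> of one argument, with \<open>\<alpha> = 1 - \<nu> / p\<close>.

  Independent stationary increments turn the expansion into a scaling limit at deterministic times: the
  characteristic function of \<open>S s\<close> at \<open>u\<close> tends to \<open>exp (c * y)\<close> when \<open>u \<rightarrow> 0\<close> and
  \<open>s * u ^ p \<rightarrow> y\<close> (\<open>char_at_scaling_limit\<close>).

  The subordinator is self-similar, since its Laplace transform is, and so is its inverse: \<open>L t\<close> has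
  the law of \<open>t powr \<nu> * L 1\<close> (\<open>subordinator_scaling\<close>, \<open>inverse_process_scaling\<close>).

  Independence of \<open>S\<close> and \<open>L\<close> lets one freeze the random time (\<open>char_random_time\<close>), so the
  characteristic function of \<open>t powr (- \<nu> / p) * S (L t)\<close> at \<open>u\<close> is an average over \<open>L 1\<close> of
  characteristic functions of \<open>S\<close> at the deterministic times \<open>t powr \<nu> * L 1\<close>. By the scaling limit and
  dominated convergence it tends to the expectation of \<open>exp (c * u ^ p * L 1)\<close>
  (\<open>char_time_changed_limit\<close>). For \<open>p = 1\<close> this is the characteristic function of \<open>m * L 1\<close>, for
  \<open>p = 2\<close> that of the normal variance mixture \<open>sqrt (q * \<Lambda>) * Z\<close> (\<open>char_normal_mixture\<close>), and
  Levy's continuity theorem concludes.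
\<close>

section \<open>Exponential limits, moments and power series\<close>

text \<open>The complex form of \<open>(1 + w / k) ^ k \<longrightarrow> exp w\<close> with varying numerator: the power is
  \<open>exp (k * Ln (1 + z))\<close>, and \<open>Ln (1 + z)\<close> agrees with \<open>z\<close> to first order. The values need to be
  complex because a drift contributes an imaginary exponent.\<close>

lemma tendsto_one_plus_power_exp:
  fixes z :: "nat \<Rightarrow> complex" and k :: "nat \<Rightarrow> nat"
  assumes z: "z \<longlonglongrightarrow> 0" and kz: "(\<lambda>n. of_nat (k n) * z n) \<longlonglongrightarrow> w"
  shows "(\<lambda>n. (1 + z n) ^ k n) \<longlonglongrightarrow> exp w"
proof -
  define D where "D y = (if y = 0 then 1 else Ln (1 + y) / y)" for y :: complex
  have "(Ln has_field_derivative 1) (at (1::complex))"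
    using has_field_derivative_Ln[of 1] by simp
  then have "((\<lambda>y. Ln (1 + y) / y) \<longlongrightarrow> 1) (at 0)"
    by (simp add: DERIV_def)
  then have "(D \<longlongrightarrow> 1) (at 0)"
    by (rule Lim_transform_eventually) (auto simp: D_def eventually_at_filter)
  then have "isCont D 0"
    by (simp add: isCont_def D_def)
  then have D: "(\<lambda>n. D (z n)) \<longlonglongrightarrow> 1"
    using isCont_tendsto_compose[OF _ z, of D] by (simp add: D_def)
  have "(\<lambda>n. exp (of_nat (k n) * z n * D (z n))) \<longlonglongrightarrow> exp (w * 1)"
    by (intro tendsto_intros kz D)
  moreover have "\<forall>\<^sub>F n in sequentially. norm (z n) < 1"
    using z by (metis order_tendstoD(2) tendsto_norm_zero zero_less_one)
  then have "\<forall>\<^sub>F n in sequentially. exp (of_nat (k n) * z n * D (z n)) = (1 + z n) ^ k n"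
  proof eventually_elim
    case (elim n)
    then have "1 + z n \<noteq> 0"
      by (metis add_eq_0_iff less_irrefl norm_minus_cancel norm_one)
    moreover have "z n * D (z n) = Ln (1 + z n)"
      by (simp add: D_def)
    ultimately show ?case
      by (simp add: exp_of_nat_mult mult.assoc)
  qed
  ultimately show ?thesis
    using Lim_transform_eventually by fastforce
qed

lemma exp_mult_term_le:
  fixes x r :: real
  assumes "0 \<le> r"
  shows "r ^ n * \<bar>x\<bar> ^ n / fact n \<le> exp (r * \<bar>x\<bar>)"
proof -
  have s: "(\<lambda>n. (r * \<bar>x\<bar>) ^ n / fact n) sums exp (r * \<bar>x\<bar>)"
    using exp_converges[of "r * \<bar>x\<bar>"] by (simp add: field_simps)
  have "sum (\<lambda>n. (r * \<bar>x\<bar>) ^ n / fact n) {n} \<le> exp (r * \<bar>x\<bar>)"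
    using s assms by (intro sum_le_suminf[THEN order_trans]) (auto simp: sums_iff)
  then show ?thesis by (simp add: power_mult_distrib)
qed

context prob_space begin

lemma integrable_power_of_integrable_exp:
  fixes X :: "'a \<Rightarrow> real"
  assumes X [measurable]: "X \<in> borel_measurable M" and r: "0 < r"
    and int: "integrable M (\<lambda>\<omega>. exp (r * \<bar>X \<omega>\<bar>))"
  shows "integrable M (\<lambda>\<omega>. X \<omega> ^ n)"
proof (rule Bochner_Integration.integrable_bound)
  show "integrable M (\<lambda>\<omega>. fact n / r ^ n * exp (r * \<bar>X \<omega>\<bar>))"
    using int by simp
  show "AE \<omega> in M. norm (X \<omega> ^ n) \<le> norm (fact n / r ^ n * exp (r * \<bar>X \<omega>\<bar>))"
    using r exp_mult_term_le[of r n "X _"] by (auto simp: field_simps power_abs abs_mult)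
qed simp

text \<open>Expanding the exponential and integrating term by term is legitimate since the partial sums are
  dominated by \<open>exp (r * \<bar>X\<bar>)\<close>. The complex argument lets one series serve the moment generating
  function (real \<open>z\<close>) and the characteristic function (imaginary \<open>z\<close>), so that the derivatives of the
  former at \<open>0\<close> determine the Taylor coefficients of the latter.\<close>

lemma exp_moment_sums:
  fixes z :: complex and X :: "'a \<Rightarrow> real"
  assumes X [measurable]: "X \<in> borel_measurable M" and r: "0 < r"
    and int: "integrable M (\<lambda>\<omega>. exp (r * \<bar>X \<omega>\<bar>))" and z: "norm z \<le> r"
  shows "(\<lambda>n. of_real (expectation (\<lambda>\<omega>. X \<omega> ^ n) / fact n) * z ^ n) sums
    (\<integral>\<omega>. exp (z * of_real (X \<omega>)) \<partial>M)"
proof -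
  let ?f = "\<lambda>n \<omega>. z ^ n * of_real (X \<omega> ^ n) / fact n :: complex"
  have exp_sums: "(\<lambda>n. ?f n \<omega>) sums exp (z * of_real (X \<omega>))" for \<omega>
    using exp_converges[of "z * of_real (X \<omega>)"]
    by (simp add: scaleR_conv_of_real power_mult_distrib field_simps)
  have norm_sums: "(\<lambda>n. norm (?f n \<omega>)) sums exp (norm z * \<bar>X \<omega>\<bar>)" for \<omega>
    using exp_converges[of "norm z * \<bar>X \<omega>\<bar>"]
    by (simp add: norm_mult norm_divide norm_power power_mult_distrib field_simps)
  have int_f: "integrable M (?f n)" for n
    using integrable_power_of_integrable_exp[OF X r int, of n]
    by (intro integrable_divide integrable_mult_right integrable_of_real)
  have int_z: "integrable M (\<lambda>\<omega>. exp (norm z * \<bar>X \<omega>\<bar>))"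
    by (rule Bochner_Integration.integrable_bound[OF int]) (auto intro!: mult_right_mono z)
  have "summable (\<lambda>n. \<integral>\<omega>. norm (?f n \<omega>) \<partial>M)"
  proof (rule summableI_nonneg_bounded)
    fix n
    have "(\<Sum>i<n. \<integral>\<omega>. norm (?f i \<omega>) \<partial>M) = (\<integral>\<omega>. (\<Sum>i<n. norm (?f i \<omega>)) \<partial>M)"
      by (rule Bochner_Integration.integral_sum[symmetric]) (intro integrable_norm int_f)
    also have "\<dots> \<le> (\<integral>\<omega>. exp (norm z * \<bar>X \<omega>\<bar>) \<partial>M)"
    proof (rule integral_mono)
      show "integrable M (\<lambda>\<omega>. \<Sum>i<n. norm (?f i \<omega>))"
        by (intro Bochner_Integration.integrable_sum integrable_norm int_f)
      show "(\<Sum>i<n. norm (?f i \<omega>)) \<le> exp (norm z * \<bar>X \<omega>\<bar>)" for \<omega>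
        using norm_sums[of \<omega>] sum_le_suminf[of "\<lambda>n. norm (?f n \<omega>)" "{..<n}"]
        by (auto simp: sums_iff)
    qed (rule int_z)
    finally show "(\<Sum>i<n. \<integral>\<omega>. norm (?f i \<omega>) \<partial>M) \<le> (\<integral>\<omega>. exp (norm z * \<bar>X \<omega>\<bar>) \<partial>M)" .
  qed simp
  then have "(\<lambda>n. \<integral>\<omega>. ?f n \<omega> \<partial>M) sums (\<integral>\<omega>. (\<Sum>n. ?f n \<omega>) \<partial>M)"
    using norm_sums by (intro sums_integral int_f) (auto simp: sums_iff)
  moreover have "(\<Sum>n. ?f n \<omega>) = exp (z * of_real (X \<omega>))" for \<omega>
    using exp_sums by (simp add: sums_iff)
  moreover have "(\<integral>\<omega>. ?f n \<omega> \<partial>M) = of_real (expectation (\<lambda>\<omega>. X \<omega> ^ n) / fact n) * z ^ n" for n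
    using integrable_power_of_integrable_exp[OF X r int, of n]
    by (simp del: of_real_power add: integral_complex_of_real)
  ultimately show ?thesis
    by (simp only:)
qed

lemma char_distr_eq:
  fixes X :: "'a \<Rightarrow> real"
  assumes [measurable]: "X \<in> borel_measurable M"
  shows "char (distr M borel X) u = (\<integral>\<omega>. exp (\<i> * of_real u * of_real (X \<omega>)) \<partial>M)"
  by (simp add: char_def integral_distr mult.assoc)

text \<open>For a bounded variable the series above converges everywhere, so its moments determine its
  characteristic function. Laplace transforms of nonnegative variables inherit this uniqueness: the
  transform of \<open>H\<close> at the natural numbers lists the moments of \<open>exp (- H) \<in> [0, 1]\<close>.\<close>

lemma distr_eq_of_moments_eq:
  fixes X Y :: "'a \<Rightarrow> real"
  assumes X [measurable]: "X \<in> borel_measurable M" and Y [measurable]: "Y \<in> borel_measurable M"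
    and bX: "AE \<omega> in M. \<bar>X \<omega>\<bar> \<le> B" and bY: "AE \<omega> in M. \<bar>Y \<omega>\<bar> \<le> B"
    and moments: "\<And>n. expectation (\<lambda>\<omega>. X \<omega> ^ n) = expectation (\<lambda>\<omega>. Y \<omega> ^ n)"
  shows "distr M borel X = distr M borel Y"
proof (rule Levy_uniqueness)
  show "char (distr M borel X) = char (distr M borel Y)"
  proof
    fix u :: real
    \<comment> \<open>any positive radius that is at least \<open>\<bar>u\<bar>\<close> will do\<close>
    define r where "r = \<bar>u\<bar> + 1"
    have int: "integrable M (\<lambda>\<omega>. exp (r * \<bar>W \<omega>\<bar>))"
      if [measurable]: "W \<in> borel_measurable M" and "AE \<omega> in M. \<bar>W \<omega>\<bar> \<le> B" for W
      using that(2) by (intro integrable_const_bound[where B="exp (r * B)"])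
        (auto simp: r_def elim!: eventually_mono intro!: mult_left_mono)
    have "0 < r" "norm (\<i> * of_real u) \<le> r"
      by (simp_all add: r_def norm_mult)
    note sums = exp_moment_sums[OF _ this(1) int this(2)]
    show "char (distr M borel X) u = char (distr M borel Y) u"
      using sums[OF X X bX] sums[OF Y Y bY] by (simp add: char_distr_eq moments sums_iff)
  qed
qed simp_all

text \<open>Integrability on both sides of \<open>0\<close> controls both tails, since
  \<open>exp (r * \<bar>x\<bar>) \<le> exp (r * x) + exp (- r * x)\<close>.\<close>

lemma integrable_exp_abs_of_eventually:
  fixes X :: "'a \<Rightarrow> real"
  assumes [measurable]: "X \<in> borel_measurable M"
    and "\<forall>\<^sub>F \<theta> in nhds 0. integrable M (\<lambda>\<omega>. exp (\<theta> * X \<omega>))"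
  obtains r where "0 < r" "integrable M (\<lambda>\<omega>. exp (r * \<bar>X \<omega>\<bar>))"
proof -
  obtain d where d: "0 < d" "\<And>\<theta>. \<bar>\<theta>\<bar> < d \<Longrightarrow> integrable M (\<lambda>\<omega>. exp (\<theta> * X \<omega>))"
    using assms(2) by (auto simp: eventually_nhds_metric dist_real_def)
  have "integrable M (\<lambda>\<omega>. exp (d / 2 * X \<omega>) + exp (- (d / 2) * X \<omega>))"
    using d by (intro Bochner_Integration.integrable_add d(2)) auto
  then have "integrable M (\<lambda>\<omega>. exp (d / 2 * \<bar>X \<omega>\<bar>))"
  proof (rule Bochner_Integration.integrable_bound)
    show "AE \<omega> in M. norm (exp (d / 2 * \<bar>X \<omega>\<bar>)) \<le> norm (exp (d / 2 * X \<omega>) + exp (- (d / 2) * X \<omega>))"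
      by (intro AE_I2) (simp add: abs_of_pos add_pos_pos, simp add: abs_if)
  qed simp
  with that[of "d / 2"] d(1) show ?thesis
    by simp
qed

lemma moment_generating_sums:
  fixes X :: "'a \<Rightarrow> real"
  assumes X [measurable]: "X \<in> borel_measurable M" and r: "0 < r"
    and int: "integrable M (\<lambda>\<omega>. exp (r * \<bar>X \<omega>\<bar>))" and \<theta>: "\<bar>\<theta>\<bar> < r"
  shows "(\<lambda>n. expectation (\<lambda>\<omega>. X \<omega> ^ n) / fact n * \<theta> ^ n) sums expectation (\<lambda>\<omega>. exp (\<theta> * X \<omega>))"
proof -
  have "(\<lambda>n. of_real (expectation (\<lambda>\<omega>. X \<omega> ^ n) / fact n * \<theta> ^ n)) sums
    (\<integral>\<omega>. of_real (exp (\<theta> * X \<omega>)) \<partial>M :: complex)"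
    using exp_moment_sums[OF X r int, of "of_real \<theta>"] \<theta> by (simp add: exp_of_real[symmetric])
  then show ?thesis
    by (simp only: integral_complex_of_real sums_of_real_iff)
qed

text \<open>The cumulant generating function is the logarithm of a power series for \<open>\<bar>\<theta>\<bar> < r\<close>, perhaps not
  beyond, and its second derivative at \<open>0\<close> needs the first derivative on a whole neighbourhood of \<open>0\<close>; hence the detour through
  properties that hold eventually near \<open>0\<close>.\<close>

lemma deriv_cgf_zero:
  fixes X :: "'a \<Rightarrow> real"
  assumes X [measurable]: "X \<in> borel_measurable M" and r: "0 < r"
    and int: "integrable M (\<lambda>\<omega>. exp (r * \<bar>X \<omega>\<bar>))"
  shows "deriv (cgf M X) 0 = expectation X"
    and "deriv (deriv (cgf M X)) 0 = expectation (\<lambda>\<omega>. (X \<omega>)\<^sup>2) - (expectation X)\<^sup>2"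
proof -
  define a where "a n = expectation (\<lambda>\<omega>. X \<omega> ^ n) / fact n" for n
  define F where "F \<theta> = (\<Sum>n. a n * \<theta> ^ n)" for \<theta> :: real
  define F' where "F' \<theta> = (\<Sum>n. diffs a n * \<theta> ^ n)" for \<theta> :: real
  define F'' where "F'' \<theta> = (\<Sum>n. diffs (diffs a) n * \<theta> ^ n)" for \<theta> :: real
  have sums: "(\<lambda>n. a n * \<theta> ^ n) sums expectation (\<lambda>\<omega>. exp (\<theta> * X \<omega>))" if "norm \<theta> < r" for \<theta>
    using moment_generating_sums[OF X r int] that by (simp add: a_def)
  have F_eq: "F \<theta> = expectation (\<lambda>\<omega>. exp (\<theta> * X \<omega>))" if "\<bar>\<theta>\<bar> < r" for \<theta>
    using sums[of \<theta>] that by (simp add: F_def sums_iff)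
  have summable: "summable (\<lambda>n. a n * \<theta> ^ n)" if "norm \<theta> < r" for \<theta>
    using sums[OF that] by (simp add: sums_iff)
  have summable': "summable (\<lambda>n. diffs a n * \<theta> ^ n)" if "norm \<theta> < r" for \<theta>
    using that by (rule termdiff_converges) (rule summable)
  have dF: "(F has_field_derivative F' \<theta>) (at \<theta>)" if "norm \<theta> < r" for \<theta>
    unfolding F_def F'_def using summable that by (rule termdiffs_strong')
  have dF': "(F' has_field_derivative F'' \<theta>) (at \<theta>)" if "norm \<theta> < r" for \<theta>
    unfolding F'_def F''_def using summable' that by (rule termdiffs_strong')
  have F0: "F 0 = 1" "F' 0 = expectation X" "F'' 0 = expectation (\<lambda>\<omega>. (X \<omega>)\<^sup>2)"
    unfolding F_def F'_def F''_def powser_zero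
    by (simp_all add: diffs_def a_def numeral_2_eq_2 prob_space)
  have near: "\<forall>\<^sub>F \<theta> in nhds 0. \<bar>\<theta>\<bar> < r \<and> 0 < F \<theta>"
  proof (rule eventually_conj)
    show "\<forall>\<^sub>F \<theta> in nhds 0. \<bar>\<theta>\<bar> < r"
      using r by (auto simp: eventually_nhds_metric dist_real_def)
    have "isCont F 0"
      using DERIV_isCont[OF dF] r by simp
    then have "(F \<longlongrightarrow> F 0) (nhds 0)"
      by (simp only: isCont_def tendsto_at_iff_tendsto_nhds)
    then have "(F \<longlongrightarrow> 1) (nhds 0)"
      by (simp only: F0)
    then show "\<forall>\<^sub>F \<theta> in nhds 0. 0 < F \<theta>"
      by (rule order_tendstoD) simp
  qed
  have cgf_eq: "\<forall>\<^sub>F \<theta> in nhds 0. cgf M X \<theta> = ln (F \<theta>)"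
    using near by eventually_elim (simp add: cgf_def F_eq)
  have d_ln: "((\<lambda>\<theta>. ln (F \<theta>)) has_field_derivative F' \<theta> / F \<theta>) (at \<theta>)"
    if "\<bar>\<theta>\<bar> < r \<and> 0 < F \<theta>" for \<theta>
    using that by (auto intro!: derivative_eq_intros dF)
  have "\<forall>\<^sub>F \<theta> in nhds 0. deriv (cgf M X) \<theta> = F' \<theta> / F \<theta>"
    using near eventually_eventually[THEN iffD2, OF cgf_eq]
  proof eventually_elim
    case (elim \<theta>)
    show ?case
      by (intro DERIV_imp_deriv)
        (simp add: DERIV_cong_ev[OF refl elim(2) refl] d_ln[OF elim(1)])
  qed
  note d_cgf = this
  show "deriv (cgf M X) 0 = expectation X"
    using eventually_nhds_x_imp_x[OF d_cgf] by (simp add: F0)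
  have "((\<lambda>\<theta>. F' \<theta> / F \<theta>) has_field_derivative
      (F'' 0 * F 0 - F' 0 * F' 0) / (F 0 * F 0)) (at 0)"
    using r by (intro DERIV_divide dF dF') (auto simp: F0)
  then show "deriv (deriv (cgf M X)) 0 = expectation (\<lambda>\<omega>. (X \<omega>)\<^sup>2) - (expectation X)\<^sup>2"
    by (intro DERIV_imp_deriv)
      (simp add: DERIV_cong_ev[OF refl d_cgf refl] F0 power2_eq_square)
qed

text \<open>If the moments of orders \<open>1, \<dots>, p - 1\<close> vanish, the first nontrivial term of the Taylor series of
  the characteristic function has order \<open>p\<close>. The cases of interest are \<open>p = 1\<close>, where the coefficient
  is \<open>\<i>\<close> times the mean, and \<open>p = 2\<close> for centred \<open>X\<close>, where it is minus half the variance.\<close>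

lemma char_expansion:
  fixes X :: "'a \<Rightarrow> real"
  assumes X [measurable]: "X \<in> borel_measurable M" and r: "0 < r"
    and int: "integrable M (\<lambda>\<omega>. exp (r * \<bar>X \<omega>\<bar>))" and p: "0 < p"
    and vanish: "\<And>n. 0 < n \<Longrightarrow> n < p \<Longrightarrow> expectation (\<lambda>\<omega>. X \<omega> ^ n) = 0"
  shows "((\<lambda>u. (char (distr M borel X) u - 1) / of_real u ^ p) \<longlongrightarrow>
    \<i> ^ p * of_real (expectation (\<lambda>\<omega>. X \<omega> ^ p) / fact p)) (at 0)"
proof -
  define a where "a n = complex_of_real (expectation (\<lambda>\<omega>. X \<omega> ^ n) / fact n)" for n
  define F where "F z = (\<integral>\<omega>. exp (z * of_real (X \<omega>)) \<partial>M)" for z :: complex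
  have "((\<lambda>z. (F z - 1) / z ^ p) \<longlongrightarrow> a (0 + p)) (at 0)"
  proof (rule powser_limit_0_strong[OF r])
    fix z :: complex
    assume z: "z \<noteq> 0" "norm z < r"
    have "(\<lambda>n. a n * z ^ n) sums F z"
      using exp_moment_sums[OF X r int] z by (simp add: a_def F_def)
    then have "(\<lambda>n. a (n + p) * z ^ (n + p)) sums (F z - (\<Sum>n<p. a n * z ^ n))"
      by (subst sums_iff_shift) simp
    also have "(\<Sum>n<p. a n * z ^ n) = (\<Sum>n\<in>{0}. a n * z ^ n)"
      using p by (intro sum.mono_neutral_right) (auto simp: a_def vanish)
    also have "\<dots> = 1"
      by (simp add: a_def prob_space)
    finally have "(\<lambda>n. a (n + p) * z ^ (n + p) / z ^ p) sums ((F z - 1) / z ^ p)"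
      by (rule sums_divide)
    then show "(\<lambda>n. a (n + p) * z ^ n) sums ((F z - 1) / z ^ p)"
      using z by (simp add: power_add)
  qed
  moreover have "filterlim (\<lambda>u::real. \<i> * of_real u) (at 0) (at 0)"
    by (auto simp: filterlim_at eventually_at_filter intro!: tendsto_eq_intros)
  ultimately have "((\<lambda>u. (F (\<i> * of_real u) - 1) / (\<i> * of_real u) ^ p) \<longlongrightarrow> a p) (at 0)"
    by (auto intro: filterlim_compose)
  then have "((\<lambda>u. \<i> ^ p * ((F (\<i> * of_real u) - 1) / (\<i> * of_real u) ^ p)) \<longlongrightarrow> \<i> ^ p * a p) (at 0)"
    by (intro tendsto_intros)
  then show ?thesis
    by (simp add: F_def a_def char_distr_eq power_mult_distrib)
qed

end

section \<open>Characteristic functions along a Levy process\<close>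

text \<open>By the one-sided limits the function is bounded near every point, and the interval is compact.\<close>

lemma cadlag_bounded:
  assumes f: "cadlag f" and T: "0 \<le> T"
  shows "bounded (f ` {0..T})"
proof -
  define P where "P a b \<longleftrightarrow> bounded (f ` ({0..} \<inter> {a..b}))" for a b
  have "P 0 T"
  proof (rule Bolzano)
    show "P a c" if "P a b" "P b c" "a \<le> b" "b \<le> c" for a b c
    proof -
      have "f ` ({0..} \<inter> {a..c}) = f ` ({0..} \<inter> {a..b}) \<union> f ` ({0..} \<inter> {b..c})"
        using that by (subst image_Un[symmetric]) (auto intro!: arg_cong[where f="image f"])
      then show ?thesis
        using that by (simp add: P_def)
    qed
  next
    fix x assume x: "0 \<le> x" "x \<le> T"
    have "(f \<longlongrightarrow> f x) (at_right x)"
      using f x by (simp add: cadlag_def)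
    then have "\<forall>\<^sub>F y in at_right x. dist (f y) (f x) < 1"
      by (rule tendstoD) simp
    then obtain b where b: "x < b" "\<And>y. x < y \<Longrightarrow> y < b \<Longrightarrow> dist (f y) (f x) < 1"
      by (auto simp: eventually_at_right_field)
    obtain a l where a: "a < x" "\<And>y. 0 \<le> y \<Longrightarrow> a < y \<Longrightarrow> y < x \<Longrightarrow> dist (f y) l < 1"
    proof (cases "x = 0")
      case True
      then show ?thesis
        using that[of "-1" 0] by simp
    next
      case False
      then obtain l where "(f \<longlongrightarrow> l) (at_left x)"
        using f x unfolding cadlag_def by (metis order_le_less)
      then have "\<forall>\<^sub>F y in at_left x. dist (f y) l < 1"
        by (rule tendstoD) simp
      then show ?thesis
        using that by (auto simp: eventually_at_left_field)
    qed
    \<comment> \<open>near \<open>x\<close> the values lie close to the left limit, close to the right limit, or equal \<open>f x\<close>\<close>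
    have near: "f ` ({0..} \<inter> {c..d}) \<subseteq> insert (f x) (ball l 1 \<union> ball (f x) 1)"
      if "c \<le> x" "x \<le> d" "d - c < min (x - a) (b - x)" for c d
    proof safe
      fix y assume y: "y \<in> {c..d}" "0 \<le> y" "f y \<noteq> f x" "f y \<notin> ball (f x) 1"
      then have "y < x"
        using b(2)[of y] that by (cases y x rule: linorder_cases) (auto simp: dist_commute)
      then show "f y \<in> ball l 1"
        using a(2)[of y] y that by (auto simp: dist_commute)
    qed
    have "P c d" if "c \<le> x" "x \<le> d" "d - c < min (x - a) (b - x)" for c d
      unfolding P_def by (rule bounded_subset[OF _ near[OF that]]) simp
    then show "\<exists>d>0. \<forall>c e. c \<le> x \<and> x \<le> e \<and> e - c < d \<longrightarrow> P c e"
      using a(1) b(1) by (intro exI[of _ "min (x - a) (b - x)"]) simp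
  qed (rule T)
  moreover have "{0..} \<inter> {0..T} = {0..T}"
    by auto
  ultimately show ?thesis
    by (simp add: P_def)
qed

text \<open>As a function of time the characteristic function is multiplicative, by the independence and
  stationarity of the increments, and right-continuous, because the paths are.\<close>

context levy_process begin

abbreviation char_at :: "real \<Rightarrow> real \<Rightarrow> complex" where
  "char_at t \<equiv> char (distr M borel (X t))"

lemma char_at_eq:
  assumes "0 \<le> t"
  shows "char_at t u = (\<integral>\<omega>. exp (\<i> * of_real u * of_real (X t \<omega>)) \<partial>M)"
  by (rule char_distr_eq) (rule random_variable[OF assms])

lemma char_at_add:
  assumes s: "0 \<le> s" and r: "0 \<le> r"
  shows "char_at (s + r) u = char_at s u * char_at r u"
proof -
  define \<tau> where "\<tau> i = (if i = 0 then 0 else if i = 1 then s else s + r)" for i :: nat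
  have "mono_on {..2} \<tau>"
    using s r by (auto simp: mono_on_def \<tau>_def)
  then have indep: "indep_vars (\<lambda>_. borel) (\<lambda>i \<omega>. X (\<tau> (Suc i)) \<omega> - X (\<tau> i) \<omega>) {..<2}"
    using indep_increments[of \<tau> 2] by (simp add: \<tau>_def)
  have "char_at (s + r) u = char (distr M borel (\<lambda>\<omega>. X (s + r) \<omega> - X 0 \<omega>)) u"
    using stationary_increments[of 0 "s + r"] s r by simp
  also have "(\<lambda>\<omega>. X (s + r) \<omega> - X 0 \<omega>) = (\<lambda>\<omega>. \<Sum>i<2. X (\<tau> (Suc i)) \<omega> - X (\<tau> i) \<omega>)"
    by (auto simp: \<tau>_def numeral_2_eq_2)
  also have "char (distr M borel \<dots>) u =
      (\<Prod>i<2. char (distr M borel (\<lambda>\<omega>. X (\<tau> (Suc i)) \<omega> - X (\<tau> i) \<omega>)) u)"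
    by (rule char_distr_sum[OF indep])
  also have "\<dots> = char_at s u * char_at r u"
    using stationary_increments[of 0 s] stationary_increments[of s "s + r"] s r
    by (simp add: \<tau>_def numeral_2_eq_2)
  finally show ?thesis .
qed

lemma char_at_of_nat_add:
  assumes "0 \<le> r"
  shows "char_at (of_nat k + r) u = char_at 1 u ^ k * char_at r u"
proof (induction k)
  case (Suc k)
  have "char_at (of_nat (Suc k) + r) u = char_at (1 + (of_nat k + r)) u"
    by (simp add: add_ac)
  also have "\<dots> = char_at 1 u * char_at (of_nat k + r) u"
    using assms by (intro char_at_add) auto
  finally show ?case
    by (simp add: Suc.IH)
qed simp

lemma char_at_tendsto:
  assumes t: "0 \<le> t" "\<And>n. 0 \<le> \<tau> n"
    and lim: "AE \<omega> in M. (\<lambda>n. u n * X (\<tau> n) \<omega>) \<longlonglongrightarrow> v * X t \<omega>"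
  shows "(\<lambda>n. char_at (\<tau> n) (u n)) \<longlonglongrightarrow> char_at t v"
proof -
  note [measurable] = random_variable
  have "(\<lambda>n. \<integral>\<omega>. exp (\<i> * of_real (u n) * of_real (X (\<tau> n) \<omega>)) \<partial>M)
      \<longlonglongrightarrow> (\<integral>\<omega>. exp (\<i> * of_real v * of_real (X t \<omega>)) \<partial>M)"
  proof (rule integral_dominated_convergence[where w="\<lambda>_. 1"])
    show "AE \<omega> in M. (\<lambda>n. exp (\<i> * of_real (u n) * of_real (X (\<tau> n) \<omega>)))
        \<longlonglongrightarrow> exp (\<i> * of_real v * of_real (X t \<omega>))"
      using lim
    proof eventually_elim
      case (elim \<omega>)
      have "(\<lambda>n. exp (\<i> * of_real (u n * X (\<tau> n) \<omega>))) \<longlonglongrightarrow> exp (\<i> * of_real (v * X t \<omega>))"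
        by (intro tendsto_intros elim)
      then show ?case
        by (simp add: mult.assoc)
    qed
  qed (use t in \<open>simp_all add: mult.assoc flip: of_real_mult\<close>)
  then show ?thesis
    using t by (simp add: char_at_eq)
qed

lemma char_at_right_continuous:
  assumes t: "0 \<le> t" and \<tau>: "\<tau> \<longlonglongrightarrow> t" "\<And>n. t < \<tau> n"
  shows "(\<lambda>n. char_at (\<tau> n) u) \<longlonglongrightarrow> char_at t u"
proof (rule char_at_tendsto)
  have right: "filterlim \<tau> (at_right t) sequentially"
    using \<tau> by (auto simp: filterlim_at intro!: always_eventually less_imp_neq[symmetric])
  show "AE \<omega> in M. (\<lambda>n. u * X (\<tau> n) \<omega>) \<longlonglongrightarrow> u * X t \<omega>"
    using cadlag_paths
  proof eventually_elim
    case (elim \<omega>)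
    then have "((\<lambda>t. X t \<omega>) \<longlongrightarrow> X t \<omega>) (at_right t)"
      using t by (simp add: cadlag_def)
    then show ?case
      by (intro tendsto_intros filterlim_compose[OF _ right])
  qed
qed (use t \<tau>(2) in \<open>auto intro: less_imp_le le_less_trans\<close>)

text \<open>Real times are split into an integer part, governed by the law at time \<open>1\<close>, and a remainder in
  \<open>[0, 1]\<close>. The remainder is negligible however it varies: almost every path is bounded on \<open>[0, 1]\<close>,
  so that multiplying by a null sequence sends its values to \<open>0\<close>.\<close>

lemma char_at_remainder:
  assumes u: "u \<longlonglongrightarrow> 0" and r: "\<And>n. 0 \<le> r n" "\<And>n. r n \<le> 1"
  shows "(\<lambda>n. char_at (r n) (u n)) \<longlonglongrightarrow> 1"
proof -
  have "(\<lambda>n. char_at (r n) (u n)) \<longlonglongrightarrow> char_at 0 0"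
  proof (rule char_at_tendsto)
    show "AE \<omega> in M. (\<lambda>n. u n * X (r n) \<omega>) \<longlonglongrightarrow> 0 * X 0 \<omega>"
      using cadlag_paths
    proof eventually_elim
      case (elim \<omega>)
      then obtain B where "\<And>t. t \<in> {0..1} \<Longrightarrow> norm (X t \<omega>) \<le> B"
        using cadlag_bounded[of "\<lambda>t. X t \<omega>" 1] by (force simp: bounded_iff)
      then have "Bseq (\<lambda>n. X (r n) \<omega>)"
        using r by (intro BseqI'[of _ B]) auto
      moreover have "Zfun u sequentially"
        using u by (simp add: tendsto_Zfun_iff)
      ultimately have "Zfun (\<lambda>n. u n * X (r n) \<omega>) sequentially"
        by (intro bounded_bilinear.Zfun_prod_Bfun[OF bounded_bilinear_mult])
      then show ?case
        by (simp add: tendsto_Zfun_iff)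
    qed
  qed (use r in auto)
  then show ?thesis
    by (simp add: char_at_eq prob_space)
qed

text \<open>This contains the law of large numbers (\<open>p = 1\<close>, \<open>c = \<i> * m\<close>) and the central limit theorem
  (\<open>p = 2\<close>, \<open>c = - q / 2\<close>) for the Levy process, along arbitrary real times. At integer
  times \<open>k\<close> the characteristic function is \<open>(1 + c * u ^ p + o(u ^ p)) ^ k\<close>, which converges as soon as
  \<open>k * u ^ p\<close> does.\<close>

lemma char_at_scaling_limit:
  assumes expansion: "((\<lambda>v. (char_at 1 v - 1) / of_real v ^ p) \<longlongrightarrow> c) (at 0)" and p: "0 < p"
    and u: "u \<longlonglongrightarrow> 0" "\<And>n. u n \<noteq> 0"
    and s: "\<And>n. 0 \<le> s n" "(\<lambda>n. s n * u n ^ p) \<longlonglongrightarrow> y"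
  shows "(\<lambda>n. char_at (s n) (u n)) \<longlonglongrightarrow> exp (c * of_real y)"
proof -
  define k where "k n = nat \<lfloor>s n\<rfloor>" for n
  define q where "q n = (char_at 1 (u n) - 1) / of_real (u n) ^ p" for n
  have k_eq: "real (k n) = s n - frac (s n)" for n
    using s(1)[of n] by (simp add: k_def frac_def of_nat_nat)
  have "filterlim u (at 0) sequentially"
    using u by (auto simp: filterlim_at)
  then have q: "q \<longlonglongrightarrow> c"
    unfolding q_def by (rule filterlim_compose[OF expansion])
  have up: "(\<lambda>n. u n ^ p) \<longlonglongrightarrow> 0"
    using tendsto_power[OF u(1), of p] p by (simp add: zero_power)
  have "(\<lambda>n. frac (s n) * u n ^ p) \<longlonglongrightarrow> 0"
  proof (rule tendsto_norm_zero_cancel, rule tendsto_sandwich[OF _ _ tendsto_const tendsto_norm_zero[OF up]])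
    show "\<forall>\<^sub>F n in sequentially. norm (frac (s n) * u n ^ p) \<le> norm (u n ^ p)"
      by (auto simp: abs_mult frac_lt_1 intro!: always_eventually mult_left_le_one_le less_imp_le[OF frac_lt_1])
  qed auto
  then have "(\<lambda>n. s n * u n ^ p - frac (s n) * u n ^ p) \<longlonglongrightarrow> y - 0"
    by (intro tendsto_diff s(2))
  then have kup: "(\<lambda>n. real (k n) * u n ^ p) \<longlonglongrightarrow> y"
    by (simp add: k_eq left_diff_distrib)
  have "(\<lambda>n. q n * of_real (u n ^ p)) \<longlonglongrightarrow> c * of_real 0"
    by (intro tendsto_intros q up)
  then have "(\<lambda>n. q n * of_real (u n ^ p)) \<longlonglongrightarrow> 0"
    by simp
  moreover have "(\<lambda>n. q n * of_real (real (k n) * u n ^ p)) \<longlonglongrightarrow> c * of_real y"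
    by (intro tendsto_intros q kup)
  then have "(\<lambda>n. of_nat (k n) * (q n * of_real (u n ^ p))) \<longlonglongrightarrow> c * of_real y"
    by (simp add: mult_ac)
  ultimately have "(\<lambda>n. (1 + q n * of_real (u n ^ p)) ^ k n) \<longlonglongrightarrow> exp (c * of_real y)"
    by (rule tendsto_one_plus_power_exp)
  moreover have "1 + q n * of_real (u n ^ p) = char_at 1 (u n)" for n
    using u(2)[of n] by (simp add: q_def)
  ultimately have "(\<lambda>n. char_at 1 (u n) ^ k n * char_at (frac (s n)) (u n)) \<longlonglongrightarrow> exp (c * of_real y) * 1"
    by (intro tendsto_mult char_at_remainder u) (simp_all add: frac_lt_1 less_imp_le)
  moreover have "char_at 1 (u n) ^ k n * char_at (frac (s n)) (u n) = char_at (s n) (u n)" for n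
    by (subst char_at_of_nat_add[symmetric]) (simp_all add: k_eq)
  ultimately show ?thesis
    by simp
qed

end

section \<open>Self-similarity of the inverse subordinator\<close>

text \<open>The inverse of a process with jumps satisfies only inequalities between strict and weak
  events. They suffice: a distribution function is right-continuous, so shrinking \<open>y \<down> x\<close> in
  \<open>cdf \<mu> x \<le> cdf \<mu>' y\<close> removes the discrepancy.\<close>

lemma real_distribution_eqI_interlaced:
  assumes \<mu>: "real_distribution \<mu>" and \<mu>': "real_distribution \<mu>'"
    and le: "\<And>x. measure \<mu> {..<x} \<le> measure \<mu>' {..x}" "\<And>x. measure \<mu>' {..<x} \<le> measure \<mu> {..x}"
  shows "\<mu> = \<mu>'"
proof (rule cdf_unique[OF \<mu> \<mu>'], rule ext, rule antisym)
  have cdf_le: "cdf \<rho> x \<le> cdf \<rho>' x"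
    if \<rho>: "real_distribution \<rho>" and \<rho>': "real_distribution \<rho>'"
      and le: "\<And>x. measure \<rho> {..<x} \<le> measure \<rho>' {..x}" for \<rho> \<rho>' x
  proof -
    interpret \<rho>: real_distribution \<rho> by fact
    interpret \<rho>': real_distribution \<rho>' by fact
    have "cdf \<rho> x \<le> cdf \<rho>' y" if "x < y" for y
    proof -
      have "cdf \<rho> x \<le> measure \<rho> {..<y}"
        unfolding cdf_def using that by (intro \<rho>.finite_measure_mono) auto
      then show ?thesis
        using le[of y] by (simp add: cdf_def)
    qed
    then have "\<forall>\<^sub>F y in at_right x. cdf \<rho> x \<le> cdf \<rho>' y"
      by (auto simp: eventually_at_filter)
    moreover have "(cdf \<rho>' \<longlongrightarrow> cdf \<rho>' x) (at_right x)"
      using \<rho>'.cdf_is_right_cont[of x] by (simp add: continuous_within)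
    ultimately show ?thesis
      by (intro tendsto_lowerbound[of "cdf \<rho>'" _ "at_right x"]) auto
  qed
  show "cdf \<mu> x \<le> cdf \<mu>' x" "cdf \<mu>' x \<le> cdf \<mu> x" for x
    using \<mu> \<mu>' le by (auto intro: cdf_le)
qed

context stable_subordinator begin

lemma subordinator_nonneg: "AE \<omega> in M. \<forall>u\<ge>0. 0 \<le> H u \<omega>"
  using start nondecreasing_paths
proof eventually_elim
  case (elim \<omega>)
  then show ?case
    by (metis atLeast_iff mono_onD order_refl)
qed

text \<open>Both sides have the Laplace transform \<open>exp (- u * t powr (- \<nu>) * \<xi> powr \<nu>)\<close>; evaluated at
  \<open>\<xi> = n\<close> it gives the moments of the bounded variables \<open>exp (- H)\<close>, which determine the law.\<close>

lemma subordinator_scaling: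
  assumes u: "0 \<le> u" and t: "0 < t"
  shows "distr M borel (\<lambda>\<omega>. H u \<omega> / t) = distr M borel (H (u * t powr (- \<nu>)))"
proof -
  define v where "v = u * t powr (- \<nu>)"
  have v: "0 \<le> v"
    using u by (simp add: v_def)
  have [measurable]: "H u \<in> borel_measurable M" "H v \<in> borel_measurable M"
    using u v by (auto intro: random_variable)
  have "distr M borel (\<lambda>\<omega>. exp (- (H u \<omega> / t))) = distr M borel (\<lambda>\<omega>. exp (- H v \<omega>))"
  proof (rule distr_eq_of_moments_eq)
    show "AE \<omega> in M. \<bar>exp (- (H u \<omega> / t))\<bar> \<le> 1" "AE \<omega> in M. \<bar>exp (- H v \<omega>)\<bar> \<le> 1"
      using subordinator_nonneg u v t by auto
    show "expectation (\<lambda>\<omega>. exp (- (H u \<omega> / t)) ^ n) = expectation (\<lambda>\<omega>. exp (- H v \<omega>) ^ n)" for n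
    proof -
      have "expectation (\<lambda>\<omega>. exp (- (H u \<omega> / t)) ^ n) = expectation (\<lambda>\<omega>. exp (- (n / t) * H u \<omega>))"
        by (simp add: exp_of_nat_mult[symmetric])
      also have "\<dots> = exp (- u * (n / t) powr \<nu>)"
        using u t by (intro laplace_transform) auto
      also have "u * (n / t) powr \<nu> = v * real n powr \<nu>"
        using t by (simp add: v_def powr_divide powr_minus field_simps)
      then have "exp (- u * (n / t) powr \<nu>) = exp (- v * real n powr \<nu>)"
        by simp
      also have "\<dots> = expectation (\<lambda>\<omega>. exp (- real n * H v \<omega>))"
        using v by (intro laplace_transform[symmetric]) auto
      also have "\<dots> = expectation (\<lambda>\<omega>. exp (- H v \<omega>) ^ n)"
        by (simp add: exp_of_nat_mult[symmetric])
      finally show ?thesis .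
    qed
  qed simp_all
  then have "distr (distr M borel (\<lambda>\<omega>. exp (- (H u \<omega> / t)))) borel (\<lambda>y. - ln y) =
      distr (distr M borel (\<lambda>\<omega>. exp (- H v \<omega>))) borel (\<lambda>y. - ln y)"
    by (rule arg_cong)
  then show ?thesis
    by (simp add: distr_distr comp_def flip: v_def)
qed

text \<open>Markov's inequality for \<open>exp (- H n)\<close> bounds the probability of staying below \<open>t\<close> by
  \<open>exp (t - n)\<close> for every \<open>n\<close>. Hence the infimum that defines the inverse is almost surely over a
  nonempty set.\<close>

lemma subordinator_unbounded: "AE \<omega> in M. \<exists>u\<ge>0. t < H u \<omega>"
proof -
  have [measurable]: "H (real n) \<in> borel_measurable M" for n
    by (rule random_variable) simp
  let ?A = "{\<omega> \<in> space M. \<forall>n. H (real n) \<omega> \<le> t}"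
  have "prob ?A \<le> exp (t - n)" for n :: nat
  proof -
    have nonneg: "AE \<omega> in M. 0 \<le> H n \<omega>"
      using subordinator_nonneg by (rule eventually_mono) simp
    have int: "integrable M (\<lambda>\<omega>. exp (- 1 * H n \<omega>))"
      by (rule integrable_const_bound[where B=1]) (use nonneg in auto)
    have "prob ?A = expectation (indicator ?A)"
      by simp
    also have "\<dots> \<le> expectation (\<lambda>\<omega>. exp t * exp (- 1 * H n \<omega>))"
    proof (rule integral_mono)
      show "integrable M (\<lambda>\<omega>. exp t * exp (- 1 * H n \<omega>))"
        using int by (rule integrable_mult_right)
      show "indicator ?A \<omega> \<le> exp t * exp (- 1 * H n \<omega>)" for \<omega>
        by (simp add: indicator_def flip: exp_add)
    qed (simp add: emeasure_eq_measure)
    also have "\<dots> = exp t * expectation (\<lambda>\<omega>. exp (- 1 * H n \<omega>))"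
      by (rule integral_mult_right_zero)
    also have "expectation (\<lambda>\<omega>. exp (- 1 * H n \<omega>)) = exp (- real n * 1 powr \<nu>)"
      by (rule laplace_transform) simp_all
    also have "exp t * \<dots> = exp (t - n)"
      by (simp flip: exp_add)
    finally show ?thesis .
  qed
  moreover have "(\<lambda>n. exp (t - real n)) \<longlonglongrightarrow> 0"
    by real_asymp
  ultimately have "prob ?A \<le> 0"
    by (intro LIMSEQ_le_const[of _ 0]) auto
  then have "prob ?A = 0"
    using measure_nonneg[of M ?A] by linarith
  then have "AE \<omega> in M. \<not> (\<forall>n. H (real n) \<omega> \<le> t)"
    by (subst (asm) prob_eq_0) auto
  then show ?thesis
    by (rule eventually_mono) (metis not_le of_nat_0_le_iff)
qed

lemma inverse_process_nonneg: "AE \<omega> in M. 0 \<le> inverse_process H t \<omega>"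
  using subordinator_unbounded[of t]
  by eventually_elim (auto simp: inverse_process_def intro!: cInf_greatest)

lemma inverse_process_less_imp:
  "AE \<omega> in M. \<forall>u. inverse_process H t \<omega> < u \<longrightarrow> 0 \<le> u \<and> t < H u \<omega>"
  using subordinator_unbounded[of t] nondecreasing_paths
proof eventually_elim
  case (elim \<omega>)
  show ?case
  proof safe
    fix u assume "inverse_process H t \<omega> < u"
    then have "Inf {u. 0 \<le> u \<and> t < H u \<omega>} < u"
      by (simp add: inverse_process_def)
    then obtain v where v: "0 \<le> v" "t < H v \<omega>" "v < u"
      using elim(1) cInf_lessD[of "{u. 0 \<le> u \<and> t < H u \<omega>}" u] by auto
    then show "0 \<le> u" by simp
    show "t < H u \<omega>"
      using v mono_onD[OF elim(2), of v u] by auto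
  qed
qed

lemma inverse_process_le:
  assumes "0 \<le> u" "t < H u \<omega>"
  shows "inverse_process H t \<omega> \<le> u"
  unfolding inverse_process_def using assms by (intro cInf_lower) (auto intro!: bdd_belowI[of _ 0])

text \<open>The inverse inherits self-similarity from the subordinator through
  \<open>{L t < u} \<subseteq> {t < H u} \<subseteq> {L t \<le> u}\<close> for \<open>u \<ge> 0\<close>, where the first inclusion holds up to a null set and the
  probability of the middle event depends only on \<open>u * t powr (- \<nu>)\<close>.\<close>

lemma inverse_process_scaling:
  assumes t: "0 < t"
    and L [measurable]: "inverse_process H t \<in> borel_measurable M" "inverse_process H 1 \<in> borel_measurable M"
  shows "distr M borel (inverse_process H t) = distr M borel (\<lambda>\<omega>. t powr \<nu> * inverse_process H 1 \<omega>)"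
proof (rule real_distribution_eqI_interlaced)
  let ?L = "inverse_process H" and ?v = "\<lambda>u. u * t powr (- \<nu>)"
  have upper: "prob {\<omega> \<in> space M. ?L s \<omega> < u} \<le> prob {\<omega> \<in> space M. s < H u \<omega>}"
    if [measurable]: "?L s \<in> borel_measurable M" and u: "0 \<le> u" for s u
    using inverse_process_less_imp[of s] random_variable[OF u]
    by (intro finite_measure_mono_AE) (auto elim!: eventually_mono)
  have lower: "prob {\<omega> \<in> space M. s < H u \<omega>} \<le> prob {\<omega> \<in> space M. ?L s \<omega> \<le> u}"
    if [measurable]: "?L s \<in> borel_measurable M" and u: "0 \<le> u" for s u
    using u by (intro finite_measure_mono) (auto intro: inverse_process_le)
  have middle: "prob {\<omega> \<in> space M. t < H u \<omega>} = prob {\<omega> \<in> space M. 1 < H (?v u) \<omega>}"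
    if u: "0 \<le> u" for u
  proof -
    have [measurable]: "H u \<in> borel_measurable M" "H (?v u) \<in> borel_measurable M"
      using u by (auto intro!: random_variable)
    have "measure (distr M borel (\<lambda>\<omega>. H u \<omega> / t)) {1<..} = measure (distr M borel (H (?v u))) {1<..}"
      using subordinator_scaling[OF u t] by simp
    then show ?thesis
      using t by (simp add: measure_distr vimage_def Int_def field_simps conj_commute)
  qed
  have scale: "t powr \<nu> * x < u \<longleftrightarrow> x < ?v u" "t powr \<nu> * x \<le> u \<longleftrightarrow> x \<le> ?v u" for x u
    using t by (simp_all add: powr_minus field_simps)
  have negligible: "prob {\<omega> \<in> space M. ?L s \<omega> < u} = 0"
    if [measurable]: "?L s \<in> borel_measurable M" and u: "u \<le> 0" for s u
  proof -
    have "AE \<omega> in M. \<not> ?L s \<omega> < u"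
      using inverse_process_nonneg[of s] by eventually_elim (use u in auto)
    then show ?thesis
      by (subst prob_eq_0) auto
  qed
  fix u
  show "measure (distr M borel (?L t)) {..<u} \<le> measure (distr M borel (\<lambda>\<omega>. t powr \<nu> * ?L 1 \<omega>)) {..u}"
  proof (cases "0 \<le> u")
    case True
    then have "prob {\<omega> \<in> space M. ?L t \<omega> < u} \<le> prob {\<omega> \<in> space M. ?L 1 \<omega> \<le> ?v u}"
      using upper[of t u] middle[of u] lower[of 1 "?v u"] by auto
    then show ?thesis
      by (simp add: measure_distr vimage_def Int_def scale conj_commute)
  qed (use negligible[of t u] in \<open>simp add: measure_distr vimage_def Int_def conj_commute\<close>)
  show "measure (distr M borel (\<lambda>\<omega>. t powr \<nu> * ?L 1 \<omega>)) {..<u} \<le> measure (distr M borel (?L t)) {..u}"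
  proof (cases "0 \<le> u")
    case True
    then have "prob {\<omega> \<in> space M. ?L 1 \<omega> < ?v u} \<le> prob {\<omega> \<in> space M. ?L t \<omega> \<le> u}"
      using upper[of 1 "?v u"] middle[of u] lower[of t u] by auto
    then show ?thesis
      by (simp add: measure_distr vimage_def Int_def scale conj_commute)
  next
    case False
    then have "?v u \<le> 0"
      by (simp add: mult_nonpos_nonneg)
    then show ?thesis
      using negligible[of 1 "?v u"] by (simp add: measure_distr vimage_def Int_def scale conj_commute)
  qed
qed simp_all

end

section \<open>Convergence in distribution as time tends to infinity\<close>

lemma tendsto_at_topI_positive_sequentially:
  fixes f :: "real \<Rightarrow> 'b::first_countable_topology"
  assumes *: "\<And>\<tau>. filterlim \<tau> at_top sequentially \<Longrightarrow> (\<And>n. 0 < \<tau> n) \<Longrightarrow> (\<lambda>n. f (\<tau> n)) \<longlonglongrightarrow> y"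
  shows "(f \<longlongrightarrow> y) at_top"
proof (rule tendsto_at_topI_sequentially)
  fix \<tau> :: "nat \<Rightarrow> real" assume \<tau>: "filterlim \<tau> at_top sequentially"
  have ev: "\<forall>\<^sub>F n in sequentially. max 1 (\<tau> n) = \<tau> n"
    using eventually_compose_filterlim[OF eventually_ge_at_top \<tau>, of 1] by eventually_elim simp
  have "filterlim (\<lambda>n. max 1 (\<tau> n)) at_top sequentially"
    using \<tau> by (rule filterlim_at_top_mono) simp
  then have "(\<lambda>n. f (max 1 (\<tau> n))) \<longlonglongrightarrow> y"
    by (rule *) simp
  then show "(\<lambda>n. f (\<tau> n)) \<longlonglongrightarrow> y"
    by (rule Lim_transform_eventually) (use ev in eventually_elim, simp)
qed

text \<open>Null sets of the completion are closed under taking subsets, so a modification of a measurable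
  function on a null set stays measurable there. This makes sense of the law of \<open>S (L t \<omega>) \<omega>\<close>, which
  is a limit of random variables only for almost every \<open>\<omega>\<close>.\<close>

lemma borel_measurable_completion_AE_eq:
  fixes f g :: "'a \<Rightarrow> real"
  assumes f: "f \<in> borel_measurable M" and eq: "AE x in M. f x = g x"
  shows "g \<in> borel_measurable (completion M)"
proof (rule measurableI)
  fix A :: "real set" assume A: "A \<in> sets borel"
  have f_set: "f -` A \<inter> space M \<in> sets (completion M)"
    using measurable_sets[OF f A] by simp
  have "AE x in completion M. x \<in> f -` A \<inter> space M \<longleftrightarrow> x \<in> g -` A \<inter> space M"
    using AE_completion[OF eq] by eventually_elim auto
  then have "g -` A \<inter> space M \<in> sets (completion M)"
    by (rule completion.in_sets_AE[OF _ f_set]) simp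
  then show "g -` A \<inter> space (completion M) \<in> sets (completion M)"
    by simp
qed simp

lemma converges_in_distributionI_char:
  assumes M: "prob_space M" and \<mu>: "real_distribution \<mu>"
    and X: "\<And>t. 0 < t \<Longrightarrow> X t \<in> borel_measurable (completion M)"
    and char: "\<And>u. ((\<lambda>t. char (distr (completion M) borel (X t)) u) \<longlongrightarrow> char \<mu> u) at_top"
  shows "converges_in_distribution M X \<mu>"
  unfolding converges_in_distribution_def
proof (intro conjI allI impI)
  fix x assume x: "isCont (cdf \<mu>) x"
  interpret C: prob_space "completion M"
    using M by (rule prob_space.prob_space_completion)
  show "((\<lambda>t. cdf (distr (completion M) borel (X t)) x) \<longlongrightarrow> cdf \<mu> x) at_top"
  proof (rule tendsto_at_topI_positive_sequentially)
    fix \<tau> :: "nat \<Rightarrow> real"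
    assume \<tau>: "filterlim \<tau> at_top sequentially" "\<And>n. 0 < \<tau> n"
    have "weak_conv_m (\<lambda>n. distr (completion M) borel (X (\<tau> n))) \<mu>"
      using \<tau> by (intro levy_continuity \<mu> C.real_distribution_distr X filterlim_compose[OF char]) auto
    then show "(\<lambda>n. cdf (distr (completion M) borel (X (\<tau> n))) x) \<longlonglongrightarrow> cdf \<mu> x"
      using x by (simp add: weak_conv_m_def weak_conv_def)
  qed
qed (rule X)

section \<open>Evaluation at an independent random time\<close>

text \<open>Fubini's theorem for the product of the laws of two independent random elements, pulled back to
  the original space.\<close>

lemma (in prob_space) integral_indep_pair:
  fixes h :: "'b \<Rightarrow> 'b \<Rightarrow> complex"
  assumes indep: "indep_var P A Q B"
    and h: "case_prod h \<in> borel_measurable (P \<Otimes>\<^sub>M Q)" and bound: "\<And>a b. norm (h a b) \<le> K"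
  shows "(\<integral>\<omega>. h (A \<omega>) (B \<omega>) \<partial>M) = (\<integral>\<omega>'. (\<integral>\<omega>. h (A \<omega>) (B \<omega>') \<partial>M) \<partial>M)"
proof -
  have A: "A \<in> measurable M P" and B: "B \<in> measurable M Q"
    and product: "distr M P A \<Otimes>\<^sub>M distr M Q B = distr M (P \<Otimes>\<^sub>M Q) (\<lambda>\<omega>. (A \<omega>, B \<omega>))"
    using indep unfolding indep_var_distribution_eq by blast+
  interpret D1: prob_space "distr M P A"
    by (rule prob_space_distr[OF A])
  interpret D2: prob_space "distr M Q B"
    by (rule prob_space_distr[OF B])
  interpret D: pair_prob_space "distr M P A" "distr M Q B" ..
  have inner: "(\<integral>a. h a (B \<omega>) \<partial>distr M P A) = (\<integral>\<omega>'. h (A \<omega>') (B \<omega>) \<partial>M)" if "\<omega> \<in> space M" for \<omega>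
  proof (rule integral_distr[OF A])
    have "(\<lambda>a. (a, B \<omega>)) \<in> measurable P (P \<Otimes>\<^sub>M Q)"
      using measurable_space[OF B that] by (rule measurable_Pair2')
    from measurable_compose[OF this h] show "(\<lambda>a. h a (B \<omega>)) \<in> borel_measurable P"
      by simp
  qed
  have "(\<integral>\<omega>. h (A \<omega>) (B \<omega>) \<partial>M) = (\<integral>\<omega>. case_prod h (A \<omega>, B \<omega>) \<partial>M)"
    by simp
  also have "\<dots> = integral\<^sup>L (distr M (P \<Otimes>\<^sub>M Q) (\<lambda>\<omega>. (A \<omega>, B \<omega>))) (case_prod h)"
    by (rule integral_distr[OF measurable_Pair[OF A B] h, symmetric])
  also have "\<dots> = integral\<^sup>L (distr M P A \<Otimes>\<^sub>M distr M Q B) (case_prod h)"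
    by (simp only: product)
  also have "\<dots> = (\<integral>b. (\<integral>a. h a b \<partial>distr M P A) \<partial>distr M Q B)"
  proof (rule D.integral_snd[symmetric])
    show "integrable (distr M P A \<Otimes>\<^sub>M distr M Q B) (case_prod h)"
      using h bound by (intro D.integrable_const_bound[where B=K]) auto
  qed
  also have "\<dots> = (\<integral>\<omega>. (\<integral>a. h a (B \<omega>) \<partial>distr M P A) \<partial>M)"
  proof (rule integral_distr[OF B])
    have "(\<lambda>(b, a). h a b) \<in> borel_measurable (Q \<Otimes>\<^sub>M P)"
      using measurable_compose[OF measurable_pair_swap' h] by (simp add: case_prod_beta')
    then show "(\<lambda>b. \<integral>a. h a b \<partial>distr M P A) \<in> borel_measurable Q"
      by (intro D1.borel_measurable_lebesgue_integral) (simp cong: measurable_cong_sets sets_pair_measure_cong)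
  qed
  also have "\<dots> = (\<integral>\<omega>'. (\<integral>\<omega>. h (A \<omega>) (B \<omega>') \<partial>M) \<partial>M)"
    by (rule Bochner_Integration.integral_cong) (simp_all add: inner)
  finally show ?thesis .
qed

text \<open>The smallest multiple of \<open>1 / (n + 1)\<close> strictly above \<open>x\<close>, with negative \<open>x\<close> treated as \<open>0\<close> by
  the truncation in \<open>nat\<close>. Strictness matters because right-continuity speaks about times after \<open>x\<close>;
  that there are only countably many values matters for measurability.\<close>

definition grid_above :: "nat \<Rightarrow> real \<Rightarrow> real" where
  "grid_above n x = real (nat \<lfloor>real (Suc n) * x\<rfloor> + 1) / real (Suc n)"

lemma grid_above_greater: "max 0 x < grid_above n x"
proof -
  have "real (Suc n) * max 0 x < real (nat \<lfloor>real (Suc n) * x\<rfloor> + 1)"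
  proof (cases "0 \<le> x")
    case True
    moreover have "y < real (nat \<lfloor>y\<rfloor> + 1)" if "0 \<le> y" for y :: real
      using that by linarith
    ultimately show ?thesis
      by (simp add: max_def del: of_nat_Suc of_nat_add)
  qed simp
  then show ?thesis
    unfolding grid_above_def by (subst pos_less_divide_eq) (simp_all add: mult.commute)
qed

lemma grid_above_nonneg: "0 \<le> grid_above n x"
  by (simp add: grid_above_def)

lemma grid_above_le: "grid_above n x \<le> max 0 x + 1 / real (Suc n)"
proof -
  have "real (nat \<lfloor>real (Suc n) * x\<rfloor>) \<le> real (Suc n) * max 0 x"
  proof (cases "0 \<le> x")
    case False
    then have "real (Suc n) * x \<le> 0"
      by (intro mult_nonneg_nonpos) auto
    with False show ?thesis
      by (simp add: max_def nat_eq_iff2 floor_le_iff del: of_nat_Suc)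
  qed (simp add: max_def of_nat_nat)
  then show ?thesis
    unfolding grid_above_def of_nat_add add_divide_distrib
    by (intro add_mono) (simp_all add: pos_divide_le_eq mult.commute del: of_nat_Suc)
qed

lemma grid_above_tendsto: "(\<lambda>n. grid_above n x) \<longlonglongrightarrow> max 0 x"
proof (rule tendsto_sandwich)
  show "\<forall>\<^sub>F n in sequentially. max 0 x \<le> grid_above n x"
    by (intro always_eventually allI less_imp_le grid_above_greater)
  show "\<forall>\<^sub>F n in sequentially. grid_above n x \<le> max 0 x + 1 / real (Suc n)"
    by (intro always_eventually allI grid_above_le)
  show "(\<lambda>n. max 0 x + 1 / real (Suc n)) \<longlonglongrightarrow> max 0 x"
    using tendsto_add[OF tendsto_const LIMSEQ_inverse_real_of_nat, of "max 0 x"]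
    by (simp add: inverse_eq_divide)
qed simp

lemma measurable_grid_above_comp:
  assumes f: "\<And>s. 0 \<le> s \<Longrightarrow> f s \<in> measurable M N" and g [measurable]: "g \<in> borel_measurable M"
  shows "(\<lambda>x. f (grid_above n (g x)) x) \<in> measurable M N"
  unfolding grid_above_def
  by (rule measurable_compose_countable[where f="\<lambda>i. f (real (i + 1) / real (Suc n))"
        and g="\<lambda>x. nat \<lfloor>real (Suc n) * g x\<rfloor>"]) (rule f, simp, measurable)

context levy_process begin

lemma norm_char_at_le: "0 \<le> t \<Longrightarrow> norm (char_at t u) \<le> 1"
  by (intro real_distribution.cmod_char_le_1 real_distribution_distr random_variable)

text \<open>A right-continuous function is the pointwise limit of its values on the grid points above.\<close>

lemma borel_measurable_char_at: "(\<lambda>x. char_at (max 0 x) u) \<in> borel_measurable borel"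
proof (rule borel_measurable_LIMSEQ_metric)
  show "(\<lambda>n. char_at (grid_above n x) u) \<longlonglongrightarrow> char_at (max 0 x) u" for x
    by (intro char_at_right_continuous grid_above_tendsto grid_above_greater) simp
  show "(\<lambda>x. char_at (grid_above n x) u) \<in> borel_measurable borel" for n
    by (rule measurable_grid_above_comp) simp_all
qed

lemma random_time_approximation:
  fixes T :: "'a \<Rightarrow> real"
  assumes "AE \<omega> in M. 0 \<le> T \<omega>"
  shows "AE \<omega> in M. (\<lambda>n. X (grid_above n (T \<omega>)) \<omega>) \<longlonglongrightarrow> X (T \<omega>) \<omega>"
  using assms cadlag_paths
proof eventually_elim
  case (elim \<omega>)
  then have "((\<lambda>t. X t \<omega>) \<longlongrightarrow> X (T \<omega>) \<omega>) (at_right (T \<omega>))"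
    by (simp add: cadlag_def)
  moreover have "filterlim (\<lambda>n. grid_above n (T \<omega>)) (at_right (T \<omega>)) sequentially"
    using grid_above_tendsto[of "T \<omega>"] grid_above_greater[of "T \<omega>"] elim
    by (auto simp: filterlim_at intro!: always_eventually less_imp_neq[symmetric])
  ultimately show ?case
    by (rule filterlim_compose)
qed

text \<open>On a grid the random time has countably many values, so that measurability of each \<open>X s\<close> suffices; right-continuity of almost
  every path allows passing to the limit.\<close>

lemma borel_measurable_random_time:
  fixes T :: "'a \<Rightarrow> real"
  assumes [measurable]: "T \<in> borel_measurable M" and T: "AE \<omega> in M. 0 \<le> T \<omega>"
  shows "(\<lambda>\<omega>. X (T \<omega>) \<omega>) \<in> borel_measurable (completion M)"
proof (rule borel_measurable_completion_AE_eq)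
  have [measurable]: "(\<lambda>\<omega>. X (grid_above n (T \<omega>)) \<omega>) \<in> borel_measurable M" for n
    by (rule measurable_grid_above_comp) (simp_all add: random_variable)
  show "(\<lambda>\<omega>. lim (\<lambda>n. X (grid_above n (T \<omega>)) \<omega>)) \<in> borel_measurable M"
    by (rule borel_measurable_lim_metric) measurable
  show "AE \<omega> in M. lim (\<lambda>n. X (grid_above n (T \<omega>)) \<omega>) = X (T \<omega>) \<omega>"
    using random_time_approximation[OF T] by eventually_elim (rule limI)
qed

text \<open>For a random time on the grid, the value of the process is a measurable function of the pair of
  processes, because it only reads off countably many coordinates. Hence Fubini's theorem applies to
  the product law and the time may be frozen.\<close>

lemma char_at_random_time_discrete:
  assumes indep: "indep_processes M X Y" and t: "0 \<le> t"
  shows "(\<integral>\<omega>. exp (\<i> * of_real u * of_real (X (grid_above n (Y t \<omega>)) \<omega>)) \<partial>M) =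
    (\<integral>\<omega>. char_at (grid_above n (Y t \<omega>)) u \<partial>M)"
proof -
  let ?P = "PiM {0..} (\<lambda>_. borel) :: (real \<Rightarrow> real) measure"
  let ?X = "\<lambda>\<omega>. \<lambda>t\<in>{0..}. X t \<omega>" and ?Y = "\<lambda>\<omega>. \<lambda>t\<in>{0..}. Y t \<omega>"
  define h where "h f g = exp (\<i> * of_real u * of_real (f (grid_above n (g t))))"
    for f g :: "real \<Rightarrow> real"
  have component: "(\<lambda>g. g s) \<in> borel_measurable ?P" if "0 \<le> s" for s
    using that by (intro measurable_component_singleton) simp
  have cexp_comp: "(\<lambda>y. exp (\<i> * of_real u * of_real (W y))) \<in> borel_measurable N"
    if [measurable]: "W \<in> borel_measurable N" for W :: "'z \<Rightarrow> real" and N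
    by measurable
  have "(\<lambda>y. h (fst y) (snd y)) \<in> borel_measurable (?P \<Otimes>\<^sub>M ?P)"
    unfolding h_def using t
    by (intro cexp_comp measurable_grid_above_comp[where g="\<lambda>y. snd y t" and f="\<lambda>s y. fst y s"]
        measurable_compose[OF measurable_fst component] measurable_compose[OF measurable_snd component])
  then have h: "case_prod h \<in> borel_measurable (?P \<Otimes>\<^sub>M ?P)"
    by (simp add: case_prod_beta')
  have "(\<integral>\<omega>. h (?X \<omega>) (?Y \<omega>) \<partial>M) = (\<integral>\<omega>'. (\<integral>\<omega>. h (?X \<omega>) (?Y \<omega>') \<partial>M) \<partial>M)"
  proof (rule integral_indep_pair[OF _ h])
    show "indep_var ?P ?X ?P ?Y"
      using indep by (simp only: indep_processes_def)
    show "norm (h f g) \<le> 1" for f g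
      by (simp add: h_def mult.assoc flip: of_real_mult)
  qed
  then show ?thesis
    using t by (simp add: h_def char_at_eq grid_above_nonneg)
qed

lemma indep_processes_measurable:
  assumes "indep_processes M X Y" and "0 \<le> t"
  shows "Y t \<in> borel_measurable M"
proof -
  have "(\<lambda>\<omega>. \<lambda>t\<in>{0..}. Y t \<omega>) \<in> measurable M (PiM {0..} (\<lambda>_. borel))"
    using assms(1) unfolding indep_processes_def indep_var_distribution_eq by blast
  from measurable_compose[OF this measurable_component_singleton[of t]] assms(2) show ?thesis
    by simp
qed

text \<open>Refining the grid turns the discrete identity into the general one; both sides converge by
  right-continuity. The maximum with \<open>0\<close> changes nothing almost surely but makes the integrand a
  function to which right-continuity applies for every \<open>\<omega>\<close>.\<close>

lemma char_random_time:
  assumes indep: "indep_processes M X Y" and t: "0 \<le> t"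
    and T: "AE \<omega> in M. 0 \<le> Y t \<omega>"
  shows "char (distr (completion M) borel (\<lambda>\<omega>. X (Y t \<omega>) \<omega>)) u = (\<integral>\<omega>. char_at (max 0 (Y t \<omega>)) u \<partial>M)"
proof -
  let ?e = "\<lambda>y. exp (\<i> * of_real u * of_real y)"
  interpret C: prob_space "completion M"
    by (rule prob_space_completion)
  have T_meas [measurable]: "Y t \<in> borel_measurable M"
    using indep t by (rule indep_processes_measurable)
  have X_meas [measurable]: "(\<lambda>\<omega>. X (grid_above n (Y t \<omega>)) \<omega>) \<in> borel_measurable M" for n
    by (rule measurable_grid_above_comp) (simp_all add: random_variable)
  have e_meas: "(\<lambda>\<omega>. ?e (X (grid_above n (Y t \<omega>)) \<omega>)) \<in> borel_measurable M" for n
    by measurable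
  note X_meas' [measurable] = borel_measurable_random_time[OF T_meas T]
  have "(\<lambda>n. \<integral>\<omega>. ?e (X (grid_above n (Y t \<omega>)) \<omega>) \<partial>completion M) \<longlonglongrightarrow>
      (\<integral>\<omega>. ?e (X (Y t \<omega>) \<omega>) \<partial>completion M)"
  proof (rule integral_dominated_convergence[where w="\<lambda>_. 1"])
    show "AE \<omega> in completion M. (\<lambda>n. ?e (X (grid_above n (Y t \<omega>)) \<omega>)) \<longlonglongrightarrow> ?e (X (Y t \<omega>) \<omega>)"
      using AE_completion[OF random_time_approximation[OF T]]
      by eventually_elim (intro tendsto_intros)
    show "(\<lambda>\<omega>. ?e (X (grid_above n (Y t \<omega>)) \<omega>)) \<in> borel_measurable (completion M)" for n
      by (rule measurable_completion[OF e_meas])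
  qed (simp_all add: mult.assoc flip: of_real_mult)
  then have "(\<lambda>n. \<integral>\<omega>. char_at (grid_above n (Y t \<omega>)) u \<partial>M) \<longlonglongrightarrow>
      char (distr (completion M) borel (\<lambda>\<omega>. X (Y t \<omega>) \<omega>)) u"
    by (simp add: C.char_distr_eq integral_completion[OF e_meas] char_at_random_time_discrete[OF indep t])
  moreover have "(\<lambda>n. \<integral>\<omega>. char_at (grid_above n (Y t \<omega>)) u \<partial>M) \<longlonglongrightarrow> (\<integral>\<omega>. char_at (max 0 (Y t \<omega>)) u \<partial>M)"
  proof (rule integral_dominated_convergence[where w="\<lambda>_. 1"])
    show "(\<lambda>\<omega>. char_at (max 0 (Y t \<omega>)) u) \<in> borel_measurable M"
      by (rule measurable_compose[OF T_meas borel_measurable_char_at])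
    show "(\<lambda>\<omega>. char_at (grid_above n (Y t \<omega>)) u) \<in> borel_measurable M" for n
      by (rule measurable_grid_above_comp) simp_all
    show "AE \<omega> in M. (\<lambda>n. char_at (grid_above n (Y t \<omega>)) u) \<longlonglongrightarrow> char_at (max 0 (Y t \<omega>)) u"
      by (intro AE_I2 char_at_right_continuous grid_above_tendsto grid_above_greater) simp
  qed (simp_all add: norm_char_at_le grid_above_nonneg)
  ultimately show ?thesis
    by (rule LIMSEQ_unique)
qed

end

section \<open>The time-changed process\<close>

lemma (in prob_space) char_distr_scale:
  fixes X :: "'a \<Rightarrow> real"
  assumes [measurable]: "X \<in> borel_measurable M"
  shows "char (distr M borel (\<lambda>\<omega>. a * X \<omega>)) u = char (distr M borel X) (a * u)"
  by (simp add: char_distr_eq mult_ac)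

lemma (in prob_space) indep_var_sym:
  assumes "indep_var P A Q B"
  shows "indep_var Q B P A"
proof -
  have "indep_set G F" if "indep_set F G" for F G
    using that unfolding indep_sets2_eq by (metis Int_commute mult.commute)
  with assms show ?thesis
    unfolding indep_var_eq by blast
qed

text \<open>Given \<open>\<Lambda>\<close>, the product is centred normal with variance \<open>q * \<Lambda>\<close>. The integrand is written in the
  shape \<open>exp (c * (u ^ p * \<Lambda>))\<close> with \<open>p = 2\<close> in which the limit of the time-changed process appears.\<close>

lemma (in prob_space) char_normal_mixture:
  fixes \<Lambda> Z :: "'a \<Rightarrow> real"
  assumes Z: "distributed M lborel Z std_normal_density" and indep: "indep_var borel \<Lambda> borel Z"
    and nonneg: "AE \<omega> in M. 0 \<le> \<Lambda> \<omega>" and q: "0 \<le> q"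
  shows "char (distr M borel (\<lambda>\<omega>. sqrt (q * \<Lambda> \<omega>) * Z \<omega>)) u =
    (\<integral>\<omega>. exp (of_real (- q / 2) * of_real (u ^ 2 * \<Lambda> \<omega>)) \<partial>M)"
proof -
  define h where "h z l = exp (\<i> * of_real u * of_real (sqrt (q * l) * z))" for z l :: real
  have [measurable]: "\<Lambda> \<in> borel_measurable M" "Z \<in> borel_measurable M"
    using indep by (auto dest: indep_var_rv1 indep_var_rv2)
  have "distr M borel Z = distr M lborel Z"
    by (rule distr_cong) simp_all
  also have "\<dots> = std_normal_distribution"
    using Z by (simp add: distributed_def)
  finally have char_Z: "char (distr M borel Z) v = of_real (exp (- v\<^sup>2 / 2))" for v
    by (simp add: char_std_normal_distribution)
  have "char (distr M borel (\<lambda>\<omega>. sqrt (q * \<Lambda> \<omega>) * Z \<omega>)) u = (\<integral>\<omega>. h (Z \<omega>) (\<Lambda> \<omega>) \<partial>M)"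
    by (subst char_distr_eq) (simp_all add: h_def)
  also have "\<dots> = (\<integral>\<omega>'. (\<integral>\<omega>. h (Z \<omega>) (\<Lambda> \<omega>') \<partial>M) \<partial>M)"
  proof (rule integral_indep_pair)
    show "indep_var borel Z borel \<Lambda>"
      using indep by (rule indep_var_sym)
    show "case_prod h \<in> borel_measurable (borel \<Otimes>\<^sub>M borel)"
      unfolding h_def by measurable
    show "norm (h z l) \<le> 1" for z l
      by (simp add: h_def mult.assoc flip: of_real_mult)
  qed
  also have "\<dots> = (\<integral>\<omega>. exp (of_real (- q / 2) * of_real (u ^ 2 * \<Lambda> \<omega>)) \<partial>M)"
  proof (rule integral_cong_AE)
    have inner: "(\<integral>\<omega>. h (Z \<omega>) l \<partial>M) = of_real (exp (- (u * sqrt (q * l))\<^sup>2 / 2))" for l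
      using char_distr_eq[of Z "u * sqrt (q * l)"] char_Z[of "u * sqrt (q * l)"]
      by (simp add: h_def mult_ac)
    then show "(\<lambda>\<omega>'. \<integral>\<omega>. h (Z \<omega>) (\<Lambda> \<omega>') \<partial>M) \<in> borel_measurable M"
      by simp
    show "AE \<omega>' in M. (\<integral>\<omega>. h (Z \<omega>) (\<Lambda> \<omega>') \<partial>M) =
        exp (of_real (- q / 2) * of_real (u ^ 2 * \<Lambda> \<omega>'))"
      using nonneg
    proof eventually_elim
      case (elim \<omega>)
      then have "- (u * sqrt (q * \<Lambda> \<omega>))\<^sup>2 / 2 = - q / 2 * (u\<^sup>2 * \<Lambda> \<omega>)"
        using q by (simp add: power_mult_distrib)
      then show ?case
        by (simp only: inner of_real_mult flip: exp_of_real)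
    qed
  qed simp
  finally show ?thesis .
qed

text \<open>By self-similarity the random time \<open>L t\<close> may be replaced by \<open>t powr \<nu> * L 1\<close>. For a fixed value of
  \<open>L 1\<close> this is a deterministic time that grows like \<open>t powr \<nu>\<close>, while the argument
  \<open>v = t powr (- \<nu> / p) * u\<close> is chosen so that the product of the time and \<open>v ^ p\<close> is the constant
  \<open>u ^ p * L 1\<close>. The limit in \<open>char_at_scaling_limit\<close> passes through the expectation over \<open>L 1\<close> by
  dominated convergence.\<close>

lemma char_time_changed_limit:
  fixes M :: "'a measure" and p :: nat
  assumes nu: "0 < \<nu>" and S: "levy_process M S" and H: "stable_subordinator M H \<nu>"
    and indep: "indep_processes M S (inverse_process H)" and p: "0 < p"
    and expansion: "((\<lambda>v. (char (distr M borel (S 1)) v - 1) / of_real v ^ p) \<longlongrightarrow> c) (at 0)"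
  shows "((\<lambda>t. char (distr (completion M) borel
        (\<lambda>\<omega>. t powr (- \<nu> / p) * S (inverse_process H t \<omega>) \<omega>)) u) \<longlongrightarrow>
      (\<integral>\<omega>. exp (c * of_real (u ^ p * inverse_process H 1 \<omega>)) \<partial>M)) at_top"
proof -
  interpret S: levy_process M S by fact
  interpret H: stable_subordinator M H \<nu> by fact
  interpret C: prob_space "completion M"
    by (rule S.prob_space_completion)
  let ?L = "inverse_process H"
  have L_meas: "?L t \<in> borel_measurable M" if "0 \<le> t" for t
    using indep that by (rule S.indep_processes_measurable)
  have SL_meas: "(\<lambda>\<omega>. S (?L t \<omega>) \<omega>) \<in> borel_measurable (completion M)" if "0 \<le> t" for t
    using L_meas[OF that] H.inverse_process_nonneg by (rule S.borel_measurable_random_time)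
  note [measurable] = L_meas[of 1, simplified]
  have char_eq: "char (distr (completion M) borel (\<lambda>\<omega>. t powr (- \<nu> / p) * S (?L t \<omega>) \<omega>)) u =
      (\<integral>\<omega>. S.char_at (max 0 (t powr \<nu> * ?L 1 \<omega>)) (t powr (- \<nu> / p) * u) \<partial>M)" if t: "0 < t" for t
  proof -
    let ?v = "t powr (- \<nu> / p) * u"
    have "char (distr (completion M) borel (\<lambda>\<omega>. t powr (- \<nu> / p) * S (?L t \<omega>) \<omega>)) u =
        char (distr (completion M) borel (\<lambda>\<omega>. S (?L t \<omega>) \<omega>)) ?v"
      using t by (intro C.char_distr_scale SL_meas) simp
    also have "\<dots> = (\<integral>\<omega>. S.char_at (max 0 (?L t \<omega>)) ?v \<partial>M)"
      using t by (intro S.char_random_time[OF indep _ H.inverse_process_nonneg]) simp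
    also have "\<dots> = (\<integral>x. S.char_at (max 0 x) ?v \<partial>distr M borel (?L t))"
      using t by (intro integral_distr[symmetric] L_meas S.borel_measurable_char_at) simp
    also have "distr M borel (?L t) = distr M borel (\<lambda>\<omega>. t powr \<nu> * ?L 1 \<omega>)"
      using t by (intro H.inverse_process_scaling L_meas) simp_all
    also have "(\<integral>x. S.char_at (max 0 x) ?v \<partial>distr M borel (\<lambda>\<omega>. t powr \<nu> * ?L 1 \<omega>)) =
        (\<integral>\<omega>. S.char_at (max 0 (t powr \<nu> * ?L 1 \<omega>)) ?v \<partial>M)"
      by (intro integral_distr S.borel_measurable_char_at) measurable
    finally show ?thesis .
  qed
  \<comment> \<open>at \<open>u = 0\<close> the arguments are not nonzero, so the scaling limit does not apply, but both sides are \<open>1\<close>\<close>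
  show ?thesis
  proof (cases "u = 0")
    case True
    have "char (distr (completion M) borel (\<lambda>\<omega>. t powr (- \<nu> / p) * S (?L t \<omega>) \<omega>)) u = 1"
      if "0 < t" for t
      using char_eq[OF that] True by (simp add: S.char_at_eq S.prob_space)
    then have "\<forall>\<^sub>F t in at_top. char (distr (completion M) borel (\<lambda>\<omega>. t powr (- \<nu> / p) * S (?L t \<omega>) \<omega>)) u = 1"
      by (intro eventually_mono[OF eventually_gt_at_top[of 0]]) simp
    then have "((\<lambda>t. char (distr (completion M) borel (\<lambda>\<omega>. t powr (- \<nu> / p) * S (?L t \<omega>) \<omega>)) u) \<longlongrightarrow> 1) at_top"
      by (rule tendsto_eventually)
    moreover have "(\<integral>\<omega>. exp (c * of_real (u ^ p * ?L 1 \<omega>)) \<partial>M) = 1"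
      using True p by (simp add: S.prob_space zero_power)
    ultimately show ?thesis
      by (simp only:)
  next
    case u: False
    show ?thesis
    proof (rule tendsto_at_topI_positive_sequentially)
      fix \<tau> :: "nat \<Rightarrow> real" assume \<tau>: "filterlim \<tau> at_top sequentially" "\<And>n. 0 < \<tau> n"
      define v where "v n = \<tau> n powr (- \<nu> / p) * u" for n
      have "(\<lambda>n. \<tau> n powr (- \<nu> / p)) \<longlonglongrightarrow> 0"
        using nu p by (intro tendsto_neg_powr \<tau>(1)) simp
      then have v: "v \<longlonglongrightarrow> 0"
        unfolding v_def by (rule tendsto_mult_left_zero)
      have v_nonzero: "v n \<noteq> 0" for n
        using u \<tau>(2)[of n] by (simp add: v_def)
      have v_power: "\<tau> n powr \<nu> * v n ^ p = u ^ p" for n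
        using \<tau>(2)[of n] p by (simp add: v_def power_mult_distrib powr_power powr_minus field_simps)
      have "(\<lambda>n. \<integral>\<omega>. S.char_at (max 0 (\<tau> n powr \<nu> * ?L 1 \<omega>)) (v n) \<partial>M) \<longlonglongrightarrow>
          (\<integral>\<omega>. exp (c * of_real (u ^ p * ?L 1 \<omega>)) \<partial>M)"
      proof (rule integral_dominated_convergence[where w="\<lambda>_. 1"])
        show "(\<lambda>\<omega>. S.char_at (max 0 (\<tau> n powr \<nu> * ?L 1 \<omega>)) (v n)) \<in> borel_measurable M" for n
          by (rule measurable_compose[OF _ S.borel_measurable_char_at]) measurable
        show "AE \<omega> in M. (\<lambda>n. S.char_at (max 0 (\<tau> n powr \<nu> * ?L 1 \<omega>)) (v n)) \<longlonglongrightarrow>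
            exp (c * of_real (u ^ p * ?L 1 \<omega>))"
          using H.inverse_process_nonneg[of 1]
        proof eventually_elim
          case (elim \<omega>)
          have "max 0 (\<tau> n powr \<nu> * ?L 1 \<omega>) * v n ^ p = u ^ p * ?L 1 \<omega>" for n
            using elim v_power[of n, symmetric] by (simp add: max_def mult_ac)
          then show ?case
            by (intro S.char_at_scaling_limit[OF expansion p v v_nonzero]) simp_all
        qed
      qed (simp_all add: S.norm_char_at_le)
      then show "(\<lambda>n. char (distr (completion M) borel
            (\<lambda>\<omega>. \<tau> n powr (- \<nu> / p) * S (?L (\<tau> n) \<omega>) \<omega>)) u) \<longlonglongrightarrow>
          (\<integral>\<omega>. exp (c * of_real (u ^ p * ?L 1 \<omega>)) \<partial>M)"
        by (simp only: char_eq[OF \<tau>(2)] v_def)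
    qed
  qed
qed

text \<open>The exponent \<open>\<alpha>\<close> is the one for which \<open>t powr \<alpha> / t = t powr (- \<nu> / p)\<close>; the rest is Levy's
  continuity theorem.\<close>

lemma time_changed_convergence:
  fixes M :: "'a measure" and p :: nat
  assumes nu: "0 < \<nu>" and S: "levy_process M S" and H: "stable_subordinator M H \<nu>"
    and indep: "indep_processes M S (inverse_process H)" and p: "0 < p"
    and expansion: "((\<lambda>v. (char (distr M borel (S 1)) v - 1) / of_real v ^ p) \<longlongrightarrow> c) (at 0)"
    and \<alpha>: "\<alpha> = 1 - \<nu> / p"
    and \<mu>: "real_distribution \<mu>"
      "\<And>u. char \<mu> u = (\<integral>\<omega>. exp (c * of_real (u ^ p * inverse_process H 1 \<omega>)) \<partial>M)"
  shows "converges_in_distribution M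
    (\<lambda>t \<omega>. t powr \<alpha> * (S (inverse_process H t \<omega>) \<omega> / t)) \<mu>"
proof -
  interpret S: levy_process M S by fact
  interpret H: stable_subordinator M H \<nu> by fact
  let ?Y = "\<lambda>t \<omega>. t powr \<alpha> * (S (inverse_process H t \<omega>) \<omega> / t)"
  have Y_eq: "?Y t = (\<lambda>\<omega>. t powr (- \<nu> / p) * S (inverse_process H t \<omega>) \<omega>)" if "0 < t" for t
    using that by (simp add: \<alpha> powr_diff powr_minus field_simps)
  show ?thesis
  proof (rule converges_in_distributionI_char)
    show "?Y t \<in> borel_measurable (completion M)" if "0 < t" for t
      using that S.indep_processes_measurable[OF indep, of t] H.inverse_process_nonneg[of t]
      by (intro borel_measurable_times borel_measurable_divide borel_measurable_const
          S.borel_measurable_random_time) auto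
    fix u
    have "\<forall>\<^sub>F t in at_top. char (distr (completion M) borel
          (\<lambda>\<omega>. t powr (- \<nu> / p) * S (inverse_process H t \<omega>) \<omega>)) u =
        char (distr (completion M) borel (?Y t)) u"
      by (rule eventually_mono[OF eventually_gt_at_top[of 0]]) (simp only: Y_eq)
    with char_time_changed_limit[OF nu S H indep p expansion, of u]
    show "((\<lambda>t. char (distr (completion M) borel (?Y t)) u) \<longlongrightarrow> char \<mu> u) at_top"
      unfolding \<mu>(2) by (rule Lim_transform_eventually)
  qed (rule S.prob_space_axioms, rule \<mu>(1))
qed

theorem proposition3p2:
  fixes M :: "'a measure"
    and S H L :: "real \<Rightarrow> 'a \<Rightarrow> real"
    and \<nu> m q \<alpha> :: real
  assumes nu: "0 < \<nu>" "\<nu> < 1"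
    and S: "levy_process M S"
    and cgf_finite: "\<forall>\<^sub>F \<theta> in nhds 0. integrable M (\<lambda>\<omega>. exp (\<theta> * S 1 \<omega>))"
    and H: "stable_subordinator M H \<nu>"
    and L: "L = inverse_process H"
    and indep: "indep_processes M S L"
    and m: "m = deriv (cgf M (S 1)) 0"
    and q: "q = deriv (deriv (cgf M (S 1))) 0"
    and alpha: "\<alpha> = (if m = 0 then 1 - \<nu> / 2 else 1 - \<nu>)"
  shows "(m = 0 \<longrightarrow>
      (\<forall>(N :: 'b measure) \<Lambda> Z.
        prob_space N \<longrightarrow>
        distr N borel \<Lambda> = distr M borel (L 1) \<longrightarrow>
        distributed N lborel Z std_normal_density \<longrightarrow>
        prob_space.indep_var N borel \<Lambda> borel Z \<longrightarrow>
        converges_in_distribution M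
          (\<lambda>t \<omega>. t powr \<alpha> * (S (L t \<omega>) \<omega> / t))
          (distr N borel (\<lambda>x. sqrt (q * \<Lambda> x) * Z x))))
    \<and> (m \<noteq> 0 \<longrightarrow>
        converges_in_distribution M
          (\<lambda>t \<omega>. t powr \<alpha> * (S (L t \<omega>) \<omega> / t))
          (distr M borel (\<lambda>\<omega>. m * L 1 \<omega>)))"
proof -
  interpret S: levy_process M S by fact
  interpret H: stable_subordinator M H \<nu> by fact
  have indep': "indep_processes M S (inverse_process H)"
    using indep by (simp only: L)
  have S1: "S 1 \<in> borel_measurable M"
    by (rule S.random_variable) simp
  have L1: "L 1 \<in> borel_measurable M"
    using S.indep_processes_measurable[OF indep, of 1] by simp
  obtain r where r: "0 < r" "integrable M (\<lambda>\<omega>. exp (r * \<bar>S 1 \<omega>\<bar>))"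
    using S.integrable_exp_abs_of_eventually[OF S1 cgf_finite] .
  have m_eq: "m = S.expectation (S 1)"
    and q_eq: "q = S.expectation (\<lambda>\<omega>. (S 1 \<omega>)\<^sup>2) - m\<^sup>2"
    using S.deriv_cgf_zero[OF S1 r] by (simp_all add: m q)
  show ?thesis
  proof (intro conjI impI allI)
    fix N :: "'b measure" and \<Lambda> Z
    assume m0: "m = 0" and "prob_space N"
      and \<Lambda>: "distr N borel \<Lambda> = distr M borel (L 1)"
      and Z: "distributed N lborel Z std_normal_density"
      and \<Lambda>Z: "prob_space.indep_var N borel \<Lambda> borel Z"
    interpret N: prob_space N by fact
    have [measurable]: "\<Lambda> \<in> borel_measurable N" "Z \<in> borel_measurable N"
      using \<Lambda>Z by (auto dest: N.indep_var_rv1 N.indep_var_rv2)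
    have q_moment: "q = S.expectation (\<lambda>\<omega>. (S 1 \<omega>)\<^sup>2)"
      using q_eq m0 by simp
    then have q_nonneg: "0 \<le> q"
      by simp
    have "AE x in distr M borel (L 1). 0 \<le> x"
      using H.inverse_process_nonneg[of 1] L1 by (subst AE_distr_iff) (simp_all add: L)
    then have \<Lambda>_nonneg: "AE x in N. 0 \<le> \<Lambda> x"
      unfolding \<Lambda>[symmetric] by (subst (asm) AE_distr_iff) simp_all
    show "converges_in_distribution M (\<lambda>t \<omega>. t powr \<alpha> * (S (L t \<omega>) \<omega> / t))
        (distr N borel (\<lambda>x. sqrt (q * \<Lambda> x) * Z x))"
      unfolding L
    proof (rule time_changed_convergence[OF nu(1) S H indep'])
      show "((\<lambda>v. (char (distr M borel (S 1)) v - 1) / of_real v ^ 2) \<longlongrightarrow> of_real (- q / 2)) (at 0)"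
      proof -
        have vanish: "S.expectation (\<lambda>\<omega>. S 1 \<omega> ^ n) = 0" if "0 < n" "n < 2" for n
        proof -
          have "n = 1" using that by simp
          then show ?thesis using m_eq m0 by simp
        qed
        show ?thesis
          using S.char_expansion[OF S1 r, of 2] vanish by (simp add: q_moment)
      qed
      show "\<alpha> = 1 - \<nu> / real 2"
        using m0 by (simp add: alpha)
      show "real_distribution (distr N borel (\<lambda>x. sqrt (q * \<Lambda> x) * Z x))"
        by (rule N.real_distribution_distr) measurable
      fix u
      let ?f = "\<lambda>x. exp (of_real (- q / 2) * of_real (u ^ 2 * x)) :: complex"
      have f: "?f \<in> borel_measurable borel"
        by measurable
      have "char (distr N borel (\<lambda>x. sqrt (q * \<Lambda> x) * Z x)) u = (\<integral>x. ?f (\<Lambda> x) \<partial>N)"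
        by (rule N.char_normal_mixture[OF Z \<Lambda>Z \<Lambda>_nonneg q_nonneg])
      also have "\<dots> = (\<integral>x. ?f x \<partial>distr N borel \<Lambda>)"
        by (rule integral_distr[OF _ f, symmetric]) measurable
      also have "\<dots> = (\<integral>\<omega>. ?f (L 1 \<omega>) \<partial>M)"
        unfolding \<Lambda> by (rule integral_distr[OF L1 f])
      finally show "char (distr N borel (\<lambda>x. sqrt (q * \<Lambda> x) * Z x)) u =
          (\<integral>\<omega>. ?f (inverse_process H 1 \<omega>) \<partial>M)"
        by (simp only: L)
    qed simp
  next
    assume m0: "m \<noteq> 0"
    show "converges_in_distribution M (\<lambda>t \<omega>. t powr \<alpha> * (S (L t \<omega>) \<omega> / t))
        (distr M borel (\<lambda>\<omega>. m * L 1 \<omega>))"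
      unfolding L
    proof (rule time_changed_convergence[OF nu(1) S H indep'])
      show "((\<lambda>v. (char (distr M borel (S 1)) v - 1) / of_real v ^ 1) \<longlongrightarrow> \<i> * of_real m) (at 0)"
        using S.char_expansion[OF S1 r, of 1] by (simp add: m_eq)
      show "\<alpha> = 1 - \<nu> / real 1"
        using m0 by (simp add: alpha)
      have mL: "(\<lambda>\<omega>. m * inverse_process H 1 \<omega>) \<in> borel_measurable M"
        using L1 by (simp add: L)
      then show "real_distribution (distr M borel (\<lambda>\<omega>. m * inverse_process H 1 \<omega>))"
        by (rule S.real_distribution_distr)
      show "char (distr M borel (\<lambda>\<omega>. m * inverse_process H 1 \<omega>)) u =
          (\<integral>\<omega>. exp (\<i> * of_real m * of_real (u ^ 1 * inverse_process H 1 \<omega>)) \<partial>M)" for u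
        by (simp add: S.char_distr_eq[OF mL] mult_ac)
    qed simp
  qed
qed

end
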